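(* Let $k$ be a field of characteristic $p>0$, and let $R$ be either $k[x_1,\dots,x_n]$ with $[k:k^p]<\infty$, or $k[[x_1,\dots,x_n]]$ (with $k$ arbitrary of characteristic $p$). Let $f\in R$ and let $\mathrm{Jac}(f)=\left(f,\frac{\partial f}{\partial x_1},\dots,\frac{\partial f}{\partial x_n}\right)\subseteq R$. Then for every real number $\epsilon$ with $0<\epsilon\le 1$, \[\mathrm{Jac}(f)\subseteq \tau\big((f)^{1-\epsilon}\big).\]
   Context: For $R$ as in the statement (an $F$-finite regular ring or a regular local ring of the stated type), for every ideal $J\subseteq R$ and every integer $e\ge 1$ there is a unique smallest ideal $I_e(J)$ of $R$ such that $J\subseteq I_e(J)^{[p^e]}$, where for an ideal $I$, $I^{[p^e]}$ denotes the ideal generated by all $g^{p^e}$ with $g\in I$. For a real number $t\ge 0$, the generalized test ideal is $\tau(J^t)=\bigcup_{e\ge 1} I_e\big(J^{\lceil tp^e\rceil}\big)$. For a principal ideal $(f)$, $(f)^m=(f^m)$. *)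

theory Defs
  imports Complex_Main "HOL-Algebra.Ideal"
begin

text \<open>Elements of k[x_v : v in 'v] and k[[x_v : v in 'v]] are represented by their
coefficient functions on exponent vectors ('v \<Rightarrow> nat), 'v a finite type of variables
(n = CARD('v)). Polynomials are the finitely supported coefficient functions.\<close>

type_synonym ('v, 'k) coeffs = "('v \<Rightarrow> nat) \<Rightarrow> 'k"

definition cmult :: "('v::finite, 'k::comm_ring_1) coeffs \<Rightarrow> ('v, 'k) coeffs \<Rightarrow> ('v, 'k) coeffs" where
  "cmult f g = (\<lambda>m. \<Sum>a \<in> {a. \<forall>v. a v \<le> m v}. f a * g (\<lambda>v. m v - a v))"

definition mon_ring :: "('v::finite, 'k::comm_ring_1) coeffs set \<Rightarrow> ('v, 'k) coeffs ring" where
  "mon_ring C = \<lparr> carrier = C, mult = cmult, one = (\<lambda>m. if m = (\<lambda>_. 0) then 1 else 0),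
                  zero = (\<lambda>_. 0), add = (\<lambda>f g m. f m + g m) \<rparr>"

definition poly_ring :: "('v::finite, 'k::comm_ring_1) coeffs ring" where
  "poly_ring = mon_ring {f. finite {m. f m \<noteq> 0}}"

definition pseries_ring :: "('v::finite, 'k::comm_ring_1) coeffs ring" where
  "pseries_ring = mon_ring UNIV"

definition pderiv_v :: "'v \<Rightarrow> ('v, 'k::comm_ring_1) coeffs \<Rightarrow> ('v, 'k) coeffs" where
  "pderiv_v v f = (\<lambda>m. of_nat (m v + 1) * f (m(v := m v + 1)))"

definition Jac :: "('v, 'k::comm_ring_1) coeffs ring \<Rightarrow> ('v, 'k) coeffs \<Rightarrow> ('v, 'k) coeffs set" where
  "Jac R f = genideal R (insert f (range (\<lambda>v. pderiv_v v f)))"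

definition frob_pow :: "('a, 'b) ring_scheme \<Rightarrow> nat \<Rightarrow> 'a set \<Rightarrow> 'a set" where
  "frob_pow R q I = genideal R {g [^]\<^bsub>R\<^esub> q | g. g \<in> I}"

definition I_e :: "('a, 'b) ring_scheme \<Rightarrow> nat \<Rightarrow> nat \<Rightarrow> 'a set \<Rightarrow> 'a set" where
  "I_e R p e J = (LEAST I. ideal I R \<and> J \<subseteq> frob_pow R (p ^ e) I)"

text \<open>Generalized test ideal tau((f)^t) = U_{e>=1} I_e((f)^ceil(t p^e)), using (f)^m = (f^m).\<close>
definition test_ideal_principal :: "('a, 'b) ring_scheme \<Rightarrow> nat \<Rightarrow> 'a \<Rightarrow> real \<Rightarrow> 'a set" where
  "test_ideal_principal R p f t =
     (\<Union>e \<in> {1..}. I_e R p e (genideal R {f [^]\<^bsub>R\<^esub> (nat \<lceil>t * real p ^ e\<rceil>)}))"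

definition F_finite_field :: "'k::field itself \<Rightarrow> nat \<Rightarrow> bool" where
  "F_finite_field _ p = (\<exists>B::'k set. finite B \<and> (\<forall>x. \<exists>c. x = (\<Sum>b\<in>B. c b ^ p * b)))"

end

(* For q = p^e let \<phi> range over the additive maps R -> R with \<phi>(g^q s) = g \<phi>(s).  The key point is
   that s lies in I^[q] iff \<phi>(s) lies in I for all these \<phi>; hence Frobenius powers commute with
   arbitrary intersections and the smallest root I_e exists over every field of characteristic p,
   F-finite or not.  For the nontrivial direction one eliminates monomials of s with q-th powers of
   elements of I: for polynomials this terminates, for power series it is a division algorithm with
   respect to finitely many leading monomials (Dickson), which replaces Noetherianity and
   Artin-Rees.

   For q with \<epsilon> q >= 1 the exponent m of f is at most q - 1, so f^m \<in> I^[q] puts f^(q-1) \<partial>f and f^q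
   into I^[q].  Some \<phi> maps f^q to f, and the e-fold Cartier operator maps f^(q-1) \<partial>f to \<partial>f, so f and
   \<partial>f lie in I. *)

theory Submission
  imports Defs "HOL-Library.Function_Algebras" "HOL-Computational_Algebra.Primes"
begin

text \<open>When R is free over R^q on a finite basis, the coordinates of s are the values of
  finitely many \<phi>, and s is a combination of their q-th powers. If k is infinite over k^q, a
  power series can have infinitely many nonzero coordinates; its expansion is then an infinite sum,
  while an ideal is closed only under finite sums. The proof therefore reads one coordinate at a
  time, through a functional on k, and moves the infinite part of the expansion into the multipliers
  of finitely many elements of I.

  The Cartier identity rests on additivity: (x + y)^(p-1) d(x + y) differs from x^(p-1) dx + y^(p-1)
  dy by an exact term dP, and an exact term has no coefficient at exponents congruent to p - 1 mod p
  in the direction of the derivative. This reduces the claim to monomials, where it is Fermat's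
  little theorem. Power series follow because a single coefficient of f^(p-1) df involves only
  finitely many coefficients of f.\<close>

section \<open>Exponent vectors and the ring of multivariate power series\<close>

lemma finite_exponents_le [simp]: "finite {..m}" for m :: "'v::finite \<Rightarrow> nat"
proof -
  have "{..m} = PiE UNIV (\<lambda>v. {..m v})"
    by (auto simp: le_fun_def PiE_def Pi_def)
  then show ?thesis
    by (simp add: finite_PiE)
qed

lemma exponents_le_iff: "a \<le> m \<longleftrightarrow> (\<exists>b. m = a + b)" for m :: "'v \<Rightarrow> nat"
proof
  assume "a \<le> m"
  then have "m = a + (m - a)"
    by (auto simp: le_fun_def fun_eq_iff)
  then show "\<exists>b. m = a + b"
    by blast
qed (auto simp: le_fun_def)

lemma finite_exponent_pairs [simp]: "finite {(a, b). a + b = m}" for m :: "'v::finite \<Rightarrow> nat"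
  by (rule finite_subset[of _ "{..m} \<times> {..m}"]) (auto simp: le_fun_def)

text \<open>With a type of its own, the ring of all coefficient functions gets its algebra from the
  type class \<open>comm_ring_1\<close>. Polynomials are a subset of it, so that both rings of the
  theorem are handled at once as a subset \<open>C\<close>.\<close>

typedef ('v, 'k) mps = "UNIV :: ('v, 'k) coeffs set"
  morphisms coeff Mps ..

setup_lifting type_definition_mps

lemma coeff_Mps [simp]: "coeff (Mps f) = f"
  by (simp add: Mps_inverse)

lemma mps_eq_iff: "f = g \<longleftrightarrow> (\<forall>m. coeff f m = coeff g m)"
  by (metis coeff_inject ext)

lemma mps_eqI: "(\<And>m. coeff f m = coeff g m) \<Longrightarrow> f = g"
  by (simp add: mps_eq_iff)

instantiation mps :: (finite, comm_ring_1) comm_ring_1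
begin

lift_definition zero_mps :: "('a, 'b) mps" is "\<lambda>_. 0" .
lift_definition one_mps :: "('a, 'b) mps" is "\<lambda>m. if m = (\<lambda>_. 0) then 1 else 0" .
lift_definition plus_mps :: "('a, 'b) mps \<Rightarrow> ('a, 'b) mps \<Rightarrow> ('a, 'b) mps" is "\<lambda>f g m. f m + g m" .
lift_definition minus_mps :: "('a, 'b) mps \<Rightarrow> ('a, 'b) mps \<Rightarrow> ('a, 'b) mps" is "\<lambda>f g m. f m - g m" .
lift_definition uminus_mps :: "('a, 'b) mps \<Rightarrow> ('a, 'b) mps" is "\<lambda>f m. - f m" .
lift_definition times_mps :: "('a, 'b) mps \<Rightarrow> ('a, 'b) mps \<Rightarrow> ('a, 'b) mps" is cmult .

text \<open>Summing over pairs removes the truncated subtraction of \<open>cmult\<close>;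
  commutativity and associativity become bijections between index sets.\<close>

lemma coeff_mult_pairs: "coeff (f * g) m = (\<Sum>(a, b) \<in> {(a, b). a + b = m}. coeff f a * coeff g b)"
proof -
  have "coeff (f * g) m = (\<Sum>a \<in> {a. \<forall>v. a v \<le> m v}. coeff f a * coeff g (\<lambda>v. m v - a v))"
    by (simp add: times_mps.rep_eq cmult_def)
  also have "\<dots> = (\<Sum>(a, b) \<in> {(a, b). a + b = m}. coeff f a * coeff g b)"
    by (rule sum.reindex_bij_witness[of _ fst "\<lambda>a. (a, \<lambda>v. m v - a v)"]) auto
  finally show ?thesis .
qed

instance
proof
  fix f g h :: "('a, 'b) mps"
  show "f * g = g * f"
    by (rule mps_eqI, unfold coeff_mult_pairs,
        rule sum.reindex_bij_witness[of _ "\<lambda>(a, b). (b, a)" "\<lambda>(a, b). (b, a)"])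
       (auto simp: ac_simps)
  show "f * g * h = f * (g * h)"
  proof (rule mps_eqI)
    fix m
    have "coeff (f * g * h) m =
        (\<Sum>p \<in> {(c, d). c + d = m}. \<Sum>q \<in> {(a, b). a + b = fst p}. coeff f (fst q) * coeff g (snd q) * coeff h (snd p))"
      by (simp add: coeff_mult_pairs case_prod_unfold sum_distrib_right)
    also have "\<dots> = (\<Sum>(p, q) \<in> (SIGMA p:{(c, d). c + d = m}. {(a, b). a + b = fst p}).
        coeff f (fst q) * coeff g (snd q) * coeff h (snd p))"
      by (rule sum.Sigma) auto
    also have "\<dots> = (\<Sum>(p, q) \<in> (SIGMA p:{(a, c). a + c = m}. {(b, d). b + d = snd p}).
        coeff f (fst p) * (coeff g (fst q) * coeff h (snd q)))"
      by (rule sum.reindex_bij_witness[of _ "\<lambda>((a, c), (b, d)). ((a + b, d), (a, b))"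
            "\<lambda>((c, d), (a, b)). ((a, b + d), (b, d))"]) (auto simp: ac_simps)
    also have "\<dots> = (\<Sum>p \<in> {(a, c). a + c = m}. \<Sum>q \<in> {(b, d). b + d = snd p}. coeff f (fst p) * (coeff g (fst q) * coeff h (snd q)))"
      by (rule sum.Sigma[symmetric]) auto
    also have "\<dots> = coeff (f * (g * h)) m"
      by (simp add: coeff_mult_pairs case_prod_unfold sum_distrib_left)
    finally show "coeff (f * g * h) m = coeff (f * (g * h)) m" .
  qed
  show "1 * f = f"
  proof (rule mps_eqI)
    fix m
    have "coeff (1 * f) m = (\<Sum>(a, b) \<in> {(0, m)}. coeff 1 a * coeff f b)"
      unfolding coeff_mult_pairs
      by (rule sum.mono_neutral_right) (auto simp: one_mps.rep_eq zero_fun_def split: if_splits)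
    then show "coeff (1 * f) m = coeff f m"
      by (simp add: one_mps.rep_eq zero_fun_def)
  qed
  show "(f + g) * h = f * h + g * h"
    by (rule mps_eqI)
       (simp add: coeff_mult_pairs plus_mps.rep_eq distrib_right case_prod_unfold sum.distrib)
  show "(0 :: ('a, 'b) mps) \<noteq> 1"
    by (auto simp: mps_eq_iff zero_mps.rep_eq one_mps.rep_eq)
qed (transfer; simp add: algebra_simps fun_eq_iff; fail)+

end

lemma coeff_0 [simp]: "coeff 0 m = 0"
  and coeff_1: "coeff 1 m = (if m = 0 then 1 else 0)"
  and coeff_add [simp]: "coeff (f + g) m = coeff f m + coeff g m"
  and coeff_diff [simp]: "coeff (f - g) m = coeff f m - coeff g m"
  and coeff_uminus [simp]: "coeff (- f) m = - coeff f m"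
  by (simp_all add: zero_mps.rep_eq one_mps.rep_eq plus_mps.rep_eq minus_mps.rep_eq
      uminus_mps.rep_eq zero_fun_def)

lemma coeff_sum [simp]: "coeff (sum f A) m = (\<Sum>x\<in>A. coeff (f x) m)"
  by (induction A rule: infinite_finite_induct) auto

lemma coeff_mult: "coeff (f * g) m = (\<Sum>a \<in> {..m}. coeff f a * coeff g (m - a))"
  by (simp add: times_mps.rep_eq cmult_def atMost_def le_fun_def fun_diff_def)

definition monom :: "('v \<Rightarrow> nat) \<Rightarrow> 'k \<Rightarrow> ('v::finite, 'k::comm_ring_1) mps" where
  "monom a c = Mps (\<lambda>m. if m = a then c else 0)"

lemma coeff_monom: "coeff (monom a c) m = (if m = a then c else 0)"
  by (simp add: monom_def)

lemma coeff_monom_mult: "coeff (monom a c * f) m = (if a \<le> m then c * coeff f (m - a) else 0)"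
proof -
  have "coeff (monom a c * f) m = (\<Sum>b \<in> {..m}. if b = a then c * coeff f (m - a) else 0)"
    unfolding coeff_mult by (rule sum.cong) (auto simp: coeff_monom)
  then show ?thesis
    by simp
qed

lemma monom_mult_monom: "monom a c * monom b d = monom (a + b) (c * d)"
proof (rule mps_eqI)
  fix m
  have "a \<le> m \<and> m - a = b \<longleftrightarrow> m = a + b"
    by (auto simp: le_fun_def fun_eq_iff) (metis le_add_diff_inverse)
  then show "coeff (monom a c * monom b d) m = coeff (monom (a + b) (c * d)) m"
    unfolding coeff_monom_mult coeff_monom by auto
qed

lemma monom_0_1: "monom 0 1 = 1"
  by (rule mps_eqI) (simp add: coeff_monom coeff_1)

lemma monom_power: "monom a c ^ n = monom (\<lambda>v. n * a v) (c ^ n)"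
  by (induction n) (auto simp: monom_0_1[symmetric] monom_mult_monom zero_fun_def plus_fun_def)

lemma CHAR_mps: "CHAR(('v::finite, 'k::comm_ring_1) mps) = CHAR('k)"
proof -
  have *: "of_nat n = monom (0 :: 'v \<Rightarrow> nat) (of_nat n :: 'k)" for n
    by (induction n) (auto intro!: mps_eqI simp: coeff_monom coeff_1 zero_fun_def)
  have "(of_nat n = (0 :: ('v, 'k) mps)) \<longleftrightarrow> (of_nat n = (0 :: 'k))" for n
    unfolding * by (auto simp: mps_eq_iff coeff_monom)
  then show ?thesis
    by (intro CHAR_eqI) (auto simp: of_nat_eq_0_iff_char_dvd)
qed

section \<open>The q-th power on power series\<close>

definition cutoff :: "('v \<Rightarrow> nat) \<Rightarrow> ('v::finite, 'k::comm_ring_1) mps \<Rightarrow> ('v, 'k) mps" where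
  "cutoff m f = (\<Sum>a \<in> {..m}. monom a (coeff f a))"

lemma coeff_cutoff: "coeff (cutoff m f) a = (if a \<le> m then coeff f a else 0)"
  by (simp add: cutoff_def coeff_monom)

lemma coeff_mult_eq_0:
  assumes "\<And>a. a \<le> m \<Longrightarrow> coeff f a = 0"
  shows "coeff (f * g) m = 0"
  unfolding coeff_mult using assms by (intro sum.neutral) auto

text \<open>Additivity of the q-th power covers finite sums only, so f is first reduced to finitely
  many monomials. The remainder h has no exponent below m, and neither has its multiple h^q.\<close>

lemma coeff_power_cutoff:
  assumes "prime CHAR('k::comm_ring_1)" "q = CHAR('k) ^ e"
  shows "coeff ((f :: ('v::finite, 'k) mps) ^ q) m = coeff (cutoff m f ^ q) m"
proof -
  define h where "h = f - cutoff m f"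
  have q: "q > 0"
    using assms by (simp add: prime_gt_0_nat)
  have "f = cutoff m f + h"
    by (simp add: h_def)
  then have "f ^ q = cutoff m f ^ q + h ^ q"
    using freshmans_dream'[where x = "cutoff m f" and y = h and n = e] assms by (simp add: CHAR_mps)
  moreover have "coeff (h ^ q) m = 0"
  proof -
    have "h ^ q = h * h ^ (q - 1)"
      using q by (metis power_eq_if not_gr_zero)
    then show ?thesis
      by (metis (no_types, lifting) coeff_mult_eq_0 coeff_cutoff coeff_diff h_def right_minus_eq)
  qed
  ultimately show ?thesis
    by simp
qed

lemma coeff_power_char:
  assumes "prime CHAR('k::comm_ring_1)" "q = CHAR('k) ^ e"
  shows "coeff ((f :: ('v::finite, 'k) mps) ^ q) m =
    (if \<forall>v. q dvd m v then coeff f (\<lambda>v. m v div q) ^ q else 0)"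
proof -
  have q: "q > 0"
    using assms by (simp add: prime_gt_0_nat)
  have "coeff (f ^ q) m = (\<Sum>a \<in> {..m}. coeff (monom a (coeff f a) ^ q) m)"
    using assms
    by (subst coeff_power_cutoff[OF assms], unfold cutoff_def, subst freshmans_dream_sum'[where n = e])
       (auto simp: CHAR_mps)
  also have "\<dots> = (\<Sum>a \<in> {..m}. if m = (\<lambda>v. q * a v) then coeff f a ^ q else 0)"
    by (simp add: monom_power coeff_monom)
  also have "\<dots> = (if \<forall>v. q dvd m v then coeff f (\<lambda>v. m v div q) ^ q else 0)"
  proof (cases "\<forall>v. q dvd m v")
    case True
    have "m = (\<lambda>v. q * a v) \<longleftrightarrow> a = (\<lambda>v. m v div q)" for a
      using True q by (auto simp: fun_eq_iff)
    then show ?thesis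
      using True by (simp add: le_fun_def)
  qed (auto intro!: sum.neutral)
  finally show ?thesis .
qed

section \<open>Ideals of a subring and p^(-e)-linear maps\<close>

definition ideal_in :: "'a::comm_ring_1 set \<Rightarrow> 'a set \<Rightarrow> bool" where
  "ideal_in C I \<longleftrightarrow> I \<subseteq> C \<and> 0 \<in> I \<and> (\<forall>x\<in>I. \<forall>y\<in>I. x + y \<in> I) \<and> (\<forall>r\<in>C. \<forall>x\<in>I. r * x \<in> I)"

definition ideal_hull :: "'a::comm_ring_1 set \<Rightarrow> 'a set \<Rightarrow> 'a set" where
  "ideal_hull C S = \<Inter>{I. ideal_in C I \<and> S \<subseteq> I}"

text \<open>For q = p^e these play the role of Hom(F^e_* R, R) with R = \<open>C\<close>. The
  identities are imposed on the whole type, free of side conditions; for polynomials this selects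
  maps that extend to power series, as the coordinate maps used below do.\<close>

definition cartier_maps :: "'a::comm_ring_1 set \<Rightarrow> nat \<Rightarrow> ('a \<Rightarrow> 'a) set" where
  "cartier_maps C q = {\<phi>. (\<forall>s\<in>C. \<phi> s \<in> C) \<and> (\<forall>s t. \<phi> (s + t) = \<phi> s + \<phi> t) \<and> (\<forall>g s. \<phi> (g ^ q * s) = g * \<phi> s)}"

lemma ideal_inD:
  assumes "ideal_in C I"
  shows "I \<subseteq> C" "0 \<in> I" "x \<in> I \<Longrightarrow> y \<in> I \<Longrightarrow> x + y \<in> I" "r \<in> C \<Longrightarrow> x \<in> I \<Longrightarrow> r * x \<in> I"
  using assms by (auto simp: ideal_in_def)

lemma cartier_mapsD:
  assumes "\<phi> \<in> cartier_maps C q"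
  shows "s \<in> C \<Longrightarrow> \<phi> s \<in> C" "\<phi> (s + t) = \<phi> s + \<phi> t" "\<phi> (g ^ q * s) = g * \<phi> s"
  using assms by (auto simp: cartier_maps_def)

lemma cartier_maps_0:
  assumes "\<phi> \<in> cartier_maps C q"
  shows "\<phi> 0 = 0"
  using cartier_mapsD(2)[OF assms, of 0 0] by simp

lemma cartier_maps_diff:
  assumes "\<phi> \<in> cartier_maps C q"
  shows "\<phi> (s - t) = \<phi> s - \<phi> t"
  using cartier_mapsD(2)[OF assms, of "s - t" t] by simp

lemma ideal_hull_superset: "S \<subseteq> ideal_hull C S"
  by (auto simp: ideal_hull_def)

lemma ideal_hull_least: "ideal_in C I \<Longrightarrow> S \<subseteq> I \<Longrightarrow> ideal_hull C S \<subseteq> I"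
  by (auto simp: ideal_hull_def)

locale subring_set =
  fixes C :: "'a::comm_ring_1 set"
  assumes zero_in: "0 \<in> C" and one_in: "1 \<in> C" and uminus_in: "x \<in> C \<Longrightarrow> - x \<in> C"
    and add_in: "x \<in> C \<Longrightarrow> y \<in> C \<Longrightarrow> x + y \<in> C" and mult_in: "x \<in> C \<Longrightarrow> y \<in> C \<Longrightarrow> x * y \<in> C"
begin

lemma diff_in: "x \<in> C \<Longrightarrow> y \<in> C \<Longrightarrow> x - y \<in> C"
  using add_in[of x "- y"] uminus_in[of y] by simp

lemma power_in: "x \<in> C \<Longrightarrow> x ^ n \<in> C"
  by (induction n) (auto intro: one_in mult_in)

lemma ideal_in_self: "ideal_in C C"
  by (auto simp: ideal_in_def zero_in add_in mult_in)

lemma ideal_in_Inter: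
  assumes "\<And>I. I \<in> \<A> \<Longrightarrow> ideal_in C I" "\<A> \<noteq> {}"
  shows "ideal_in C (\<Inter>\<A>)"
  using assms unfolding ideal_in_def by blast

lemma ideal_hull_ideal:
  assumes "S \<subseteq> C"
  shows "ideal_in C (ideal_hull C S)"
  unfolding ideal_hull_def using assms ideal_in_self by (intro ideal_in_Inter) auto

lemma ideal_in_uminus: "ideal_in C I \<Longrightarrow> x \<in> I \<Longrightarrow> - x \<in> I"
  using ideal_inD(4)[of C I "-1" x] uminus_in[OF one_in] by simp

lemma ideal_in_diff: "ideal_in C I \<Longrightarrow> x \<in> I \<Longrightarrow> y \<in> I \<Longrightarrow> x - y \<in> I"
  using ideal_inD(3)[of C I x "- y"] ideal_in_uminus[of I y] by simp

lemma ideal_in_sum: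
  assumes "ideal_in C I" "\<And>x. x \<in> A \<Longrightarrow> f x \<in> I"
  shows "sum f A \<in> I"
  using assms(2) by (induction A rule: infinite_finite_induct) (auto simp: ideal_inD[OF assms(1)])

lemma cartier_maps_premult:
  assumes "\<phi> \<in> cartier_maps C q" "r \<in> C"
  shows "(\<lambda>s. \<phi> (r * s)) \<in> cartier_maps C q"
proof -
  have "\<phi> (r * (g ^ q * s)) = g * \<phi> (r * s)" for g s
    using cartier_mapsD(3)[OF assms(1), of g "r * s"] by (simp add: mult.left_commute)
  then show ?thesis
    using assms mult_in unfolding cartier_maps_def by (simp add: distrib_left)
qed

text \<open>The set of all s with \<open>\<phi> s \<in> I\<close> for every \<open>p\<^sup>-\<^sup>e\<close>-linear map \<open>\<phi>\<close> is an ideal because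
precomposing \<open>\<phi>\<close> with a multiplication gives such a map again.\<close>

lemma cartier_maps_ideal_hull:
  assumes I: "ideal_in C I" and s: "s \<in> ideal_hull C ((\<lambda>g. g ^ q) ` I)" and \<phi>: "\<phi> \<in> cartier_maps C q"
  shows "\<phi> s \<in> I"
proof -
  define K where "K = {s \<in> C. \<forall>\<phi> \<in> cartier_maps C q. \<phi> s \<in> I}"
  have "r * x \<in> K" if "r \<in> C" "x \<in> K" for r x
    using that cartier_maps_premult[of _ q r] unfolding K_def by (auto intro: mult_in)
  then have "ideal_in C K"
    unfolding ideal_in_def
    by (auto simp: K_def zero_in add_in cartier_maps_0 cartier_mapsD(2) ideal_inD[OF I])
  moreover have "g ^ q \<in> K" if "g \<in> I" for g
  proof -
    have gC: "g \<in> C"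
      using that I ideal_inD(1) by blast
    have "\<phi> (g ^ q) \<in> I" if \<phi>: "\<phi> \<in> cartier_maps C q" for \<phi>
    proof -
      have "\<phi> (g ^ q) = \<phi> 1 * g"
        using cartier_mapsD(3)[OF \<phi>, of g 1] by (simp add: mult.commute)
      then show ?thesis
        using ideal_inD(4)[OF I _ \<open>g \<in> I\<close>] cartier_mapsD(1)[OF \<phi> one_in] by metis
    qed
    then show ?thesis
      by (simp add: K_def power_in gC)
  qed
  ultimately have "ideal_hull C ((\<lambda>g. g ^ q) ` I) \<subseteq> K"
    by (intro ideal_hull_least) auto
  then show ?thesis
    using s \<phi> by (auto simp: K_def)
qed

end

section \<open>Polynomials and power series as subrings\<close>

definition polys :: "('v::finite, 'k::comm_ring_1) mps set" where
  "polys = {f. finite {m. coeff f m \<noteq> 0}}"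

lemma monom_in_polys: "monom a c \<in> polys"
  by (auto simp: polys_def coeff_monom)

interpretation polys: subring_set "polys :: ('v::finite, 'k::comm_ring_1) mps set"
proof
  fix f g :: "('v, 'k) mps"
  show "0 \<in> (polys :: ('v, 'k) mps set)" "1 \<in> (polys :: ('v, 'k) mps set)"
    by (simp_all add: polys_def coeff_1)
  show "- f \<in> polys" if "f \<in> polys"
    using that by (simp add: polys_def)
  show "f + g \<in> polys" if "f \<in> polys" "g \<in> polys"
  proof -
    have "{m. coeff (f + g) m \<noteq> 0} \<subseteq> {m. coeff f m \<noteq> 0} \<union> {m. coeff g m \<noteq> 0}"
      by auto
    then show ?thesis
      using that finite_subset unfolding polys_def by blast
  qed
  show "f * g \<in> polys" if "f \<in> polys" "g \<in> polys"
  proof -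
    have "{m. coeff (f * g) m \<noteq> 0} \<subseteq> (\<lambda>(a, b). a + b) ` ({m. coeff f m \<noteq> 0} \<times> {m. coeff g m \<noteq> 0})"
    proof
      fix m
      assume "m \<in> {m. coeff (f * g) m \<noteq> 0}"
      then have "(\<Sum>(a, b) \<in> {(a, b). a + b = m}. coeff f a * coeff g b) \<noteq> 0"
        by (simp add: coeff_mult_pairs)
      then obtain x where "x \<in> {(a, b). a + b = m}" "(case x of (a, b) \<Rightarrow> coeff f a * coeff g b) \<noteq> 0"
        by (rule sum.not_neutral_contains_not_neutral)
      then show "m \<in> (\<lambda>(a, b). a + b) ` ({m. coeff f m \<noteq> 0} \<times> {m. coeff g m \<noteq> 0})"
        by (cases x) (auto intro!: image_eqI[of _ _ x])
    qed
    then show ?thesis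
      using that unfolding polys_def mem_Collect_eq
      by (meson finite_SigmaI finite_imageI finite_subset)
  qed
qed

interpretation all: subring_set UNIV
  by standard auto

section \<open>Coordinate maps over the q-th powers\<close>

text \<open>For q a power of the characteristic, these are the linear functionals on k when a scalar
  c acts as multiplication by c^q.\<close>

definition dual_maps :: "nat \<Rightarrow> ('k::comm_ring_1 \<Rightarrow> 'k) set" where
  "dual_maps q = {l. (\<forall>x y. l (x + y) = l x + l y) \<and> (\<forall>c x. l (c ^ q * x) = c * l x)}"

lemma dual_maps_0:
  assumes "l \<in> dual_maps q"
  shows "l 0 = 0"
proof -
  have "l (0 + 0) = l 0 + l 0"
    using assms unfolding dual_maps_def by blast
  then show ?thesis
    by simp
qed

lemma dual_maps_sum:
  assumes "l \<in> dual_maps q"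
  shows "l (sum f A) = (\<Sum>x\<in>A. l (f x))"
  using assms dual_maps_0[OF assms]
  by (induction A rule: infinite_finite_induct) (simp_all add: dual_maps_def)

lemma ex_dual_map:
  fixes x :: "'k::field"
  assumes "prime CHAR('k)" "q = CHAR('k) ^ e" "x \<noteq> 0"
  obtains l where "l \<in> dual_maps q" "l x = 1"
proof -
  \<comment> \<open>Letting k act on itself through the q-th power makes coordinates come out as q-th roots.\<close>
  interpret vector_space "\<lambda>(c::'k) x::'k. c ^ q * x"
    by standard
       (use assms in \<open>auto simp: algebra_simps power_mult_distrib freshmans_dream'[where n = e]\<close>)
  \<comment> \<open>The basis may be infinite: only the coordinate at x is taken from it.\<close>
  define B where "B = extend_basis {x}"
  have "independent {x}"
    using assms(3) by (simp add: dependent_single)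
  then have B: "independent B" "span B = UNIV" "x \<in> B"
    using extend_basis_superset[of "{x}"] independent_extend_basis[of "{x}"] span_extend_basis[of "{x}"]
    unfolding B_def by auto
  show ?thesis
  proof (rule that[of "\<lambda>y. representation B y x"])
    show "(\<lambda>y. representation B y x) \<in> dual_maps q"
      using B by (auto simp: dual_maps_def representation_add representation_scale)
    show "representation B x x = 1"
      using B by (simp add: representation_basis)
  qed
qed

text \<open>With \<alpha> below q and l the coordinate at a basis element b of k over k^q, this is
  the q-th root of the coordinate of s at b x^\<alpha>: the exponents congruent to \<alpha> mod q
  are divided by q, and l acts on their coefficients.\<close>

definition coeff_map :: "nat \<Rightarrow> ('k \<Rightarrow> 'k) \<Rightarrow> ('v \<Rightarrow> nat) \<Rightarrow> ('v::finite, 'k::comm_ring_1) mps \<Rightarrow> ('v, 'k) mps" where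
  "coeff_map q l \<alpha> s = Mps (\<lambda>m. l (coeff s (\<lambda>v. q * m v + \<alpha> v)))"

lemma coeff_coeff_map: "coeff (coeff_map q l \<alpha> s) m = l (coeff s (\<lambda>v. q * m v + \<alpha> v))"
  by (simp add: coeff_map_def)

text \<open>Only exponents q a occur in g^q, so the coefficient of g^q s at q m + \<alpha> is a
  convolution over a, and l pulls each coefficient of g out of its q-th power.\<close>

lemma coeff_map_power_mult:
  fixes g s :: "('v::finite, 'k::comm_ring_1) mps"
  assumes "prime CHAR('k)" "q = CHAR('k) ^ e" and l: "l \<in> dual_maps q" and \<alpha>: "\<And>v. \<alpha> v < q"
  shows "coeff_map q l \<alpha> (g ^ q * s) = g * coeff_map q l \<alpha> s"
proof (rule mps_eqI)
  fix m
  have q: "q > 0"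
    using \<alpha>[of undefined] by simp
  let ?M = "\<lambda>v. q * m v + \<alpha> v"
  \<comment> \<open>Here \<alpha> < q matters: adding \<alpha> never reaches the next multiple of
    q.\<close>
  have le: "(\<lambda>v. q * a v) \<le> ?M \<longleftrightarrow> a \<le> m" for a
  proof -
    have "q * a v \<le> ?M v \<longleftrightarrow> a v \<le> m v" for v
    proof
      assume "q * a v \<le> ?M v"
      then have "q * a v div q \<le> ?M v div q"
        by (rule div_le_mono)
      then show "a v \<le> m v"
        using q \<alpha>[of v] by simp
    qed (simp add: trans_le_add1)
    then show ?thesis
      by (simp add: le_fun_def)
  qed
  have "coeff (g ^ q * s) ?M = (\<Sum>a \<in> (\<lambda>a v. q * a v) ` {..m}. coeff (g ^ q) a * coeff s (?M - a))"
    unfolding coeff_mult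
  proof (rule sum.mono_neutral_right)
    show "\<forall>a \<in> {..?M} - (\<lambda>a v. q * a v) ` {..m}. coeff (g ^ q) a * coeff s (?M - a) = 0"
    proof
      fix a
      assume a: "a \<in> {..?M} - (\<lambda>a v. q * a v) ` {..m}"
      have "\<not> (\<forall>v. q dvd a v)"
      proof
        assume "\<forall>v. q dvd a v"
        then have *: "a = (\<lambda>v. q * (a v div q))"
          by auto
        moreover have "(\<lambda>v. a v div q) \<in> {..m}"
          using a le[of "\<lambda>v. a v div q"] * by auto
        ultimately have "a \<in> (\<lambda>a v. q * a v) ` {..m}"
          by (rule image_eqI)
        then show False
          using a by blast
      qed
      then show "coeff (g ^ q) a * coeff s (?M - a) = 0"
        by (auto simp: coeff_power_char[OF assms(1,2)])
    qed
  qed (use le in auto)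
  also have "\<dots> = (\<Sum>a \<in> {..m}. coeff g a ^ q * coeff s (\<lambda>v. q * (m - a) v + \<alpha> v))"
  proof (subst sum.reindex)
    show "inj_on (\<lambda>a v. q * a v) {..m}"
      using q by (auto simp: inj_on_def fun_eq_iff)
    have "?M - (\<lambda>v. q * a v) = (\<lambda>v. q * (m - a) v + \<alpha> v)" if "a \<in> {..m}" for a
      using that by (auto simp: fun_eq_iff le_fun_def diff_mult_distrib2)
    then show "sum ((\<lambda>a. coeff (g ^ q) a * coeff s (?M - a)) \<circ> (\<lambda>a v. q * a v)) {..m} =
        (\<Sum>a \<in> {..m}. coeff g a ^ q * coeff s (\<lambda>v. q * (m - a) v + \<alpha> v))"
      using q by (intro sum.cong) (auto simp: coeff_power_char[OF assms(1,2)])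
  qed
  finally show "coeff (coeff_map q l \<alpha> (g ^ q * s)) m = coeff (g * coeff_map q l \<alpha> s) m"
    using l by (simp add: coeff_coeff_map coeff_mult dual_maps_sum) (simp add: dual_maps_def)
qed

lemma coeff_map_cartier:
  fixes C :: "('v::finite, 'k::comm_ring_1) mps set"
  assumes "prime CHAR('k)" "q = CHAR('k) ^ e" and l: "l \<in> dual_maps q" and \<alpha>: "\<And>v. \<alpha> v < q"
    and C: "C = polys \<or> C = UNIV"
  shows "coeff_map q l \<alpha> \<in> cartier_maps C q"
proof -
  have "coeff_map q l \<alpha> s \<in> polys" if "s \<in> polys" for s :: "('v, 'k) mps"
  proof -
    let ?f = "\<lambda>m v. q * m v + \<alpha> v"
    have "inj ?f"
      using \<alpha>[of undefined] by (auto simp: inj_def fun_eq_iff)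
    then have "finite (?f -` {m. coeff s m \<noteq> 0})"
      using that by (intro finite_vimageI) (simp add: polys_def)
    moreover have "{m. coeff (coeff_map q l \<alpha> s) m \<noteq> 0} \<subseteq> ?f -` {m. coeff s m \<noteq> 0}"
      using dual_maps_0[OF l] by (auto simp: coeff_coeff_map)
    ultimately show ?thesis
      unfolding polys_def using finite_subset by blast
  qed
  moreover have "coeff_map q l \<alpha> (s + t) = coeff_map q l \<alpha> s + coeff_map q l \<alpha> t" for s t :: "('v, 'k) mps"
    using l by (intro mps_eqI) (simp add: coeff_coeff_map dual_maps_def)
  ultimately show ?thesis
    using C coeff_map_power_mult[OF assms(1-4)] by (auto simp: cartier_maps_def)
qed

section \<open>Dickson's lemma and a monomial order\<close>

text \<open>Every sequence has a monotone or antitone subsequence, and an antitone sequence of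
  naturals is constant from the place of its minimum on.\<close>

lemma nat_seq_mono_subseq:
  fixes s :: "nat \<Rightarrow> nat"
  obtains g :: "nat \<Rightarrow> nat" where "strict_mono g" "mono (\<lambda>n. s (g n))"
proof -
  obtain g :: "nat \<Rightarrow> nat" where g: "strict_mono g" "monoseq (\<lambda>n. s (g n))"
    using seq_monosub[of s] by blast
  from g(2) consider "mono (\<lambda>n. s (g n))" | "antimono (\<lambda>n. s (g n))"
    by (auto simp: monoseq_def mono_def antimono_def)
  then show ?thesis
  proof cases
    case 2
    obtain N where N: "\<And>n. s (g N) \<le> s (g n)"
      using ex_least_nat_le[of "\<lambda>x. x \<in> range (\<lambda>n. s (g n))" "s (g 0)"]
      by (metis (mono_tags, lifting) linorder_not_less nat_le_linear rangeE rangeI order_trans)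
    have eq: "s (g (n + N)) = s (g N)" for n
      using N[of "n + N"] antimonoD[OF 2, of N "n + N"] by simp
    show ?thesis
    proof (rule that[of "\<lambda>n. g (n + N)"])
      show "strict_mono (\<lambda>n. g (n + N))"
        using g(1) by (simp add: strict_mono_def)
      show "mono (\<lambda>n. s (g (n + N)))"
        by (simp add: eq mono_def)
    qed
  qed (use g that in blast)
qed

text \<open>The sequence is thinned out for one variable after another; monotonicity in the earlier
  variables survives passing to a subsequence.\<close>

lemma exponent_seq_mono_subseq:
  fixes f :: "nat \<Rightarrow> 'v::finite \<Rightarrow> nat"
  obtains g :: "nat \<Rightarrow> nat" where "strict_mono g" "mono (\<lambda>n. f (g n))"
proof -
  have "finite V \<Longrightarrow> \<exists>g :: nat \<Rightarrow> nat. strict_mono g \<and> (\<forall>v\<in>V. mono (\<lambda>n. f (g n) v))" for V :: "'v set"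
  proof (induction V rule: finite_induct)
    case empty
    show ?case
      by (rule exI[of _ id]) (auto simp: strict_mono_def)
  next
    case (insert v V)
    then obtain g :: "nat \<Rightarrow> nat" where g: "strict_mono g" "\<And>w. w \<in> V \<Longrightarrow> mono (\<lambda>n. f (g n) w)"
      by blast
    obtain h :: "nat \<Rightarrow> nat" where h: "strict_mono h" "mono (\<lambda>n. f (g (h n)) v)"
      using nat_seq_mono_subseq[of "\<lambda>n. f (g n) v"] by blast
    have "mono (\<lambda>n. f (g (h n)) w)" if "w \<in> V" for w
      using g(2)[OF that] h(1) by (simp add: mono_def strict_mono_less_eq)
    then show ?case
      using g(1) h by (intro exI[of _ "g \<circ> h"]) (auto simp: strict_mono_def)
  qed
  from this[of UNIV] obtain g :: "nat \<Rightarrow> nat" where "strict_mono g" "\<And>v. mono (\<lambda>n. f (g n) v)"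
    by auto
  then show ?thesis
    by (intro that[of g]) (auto simp: mono_def le_fun_def)
qed

text \<open>\<open>T\<close> consists of the minimal elements. An infinite \<open>T\<close> would
  contain a monotone sequence of distinct elements, contradicting minimality; that every element
  lies above a minimal one follows by descent on the total degree.\<close>

lemma Dickson:
  fixes S :: "('v::finite \<Rightarrow> nat) set"
  obtains T where "finite T" "T \<subseteq> S" "\<forall>m\<in>S. \<exists>t\<in>T. t \<le> m"
proof -
  define T where "T = {t \<in> S. \<forall>s\<in>S. s \<le> t \<longrightarrow> s = t}"
  have "finite T"
  proof (rule ccontr)
    assume "infinite T"
    then obtain f :: "nat \<Rightarrow> 'v \<Rightarrow> nat" where f: "inj f" "range f \<subseteq> T"
      using infinite_countable_subset by blast
    obtain g :: "nat \<Rightarrow> nat" where g: "strict_mono g" "mono (\<lambda>n. f (g n))"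
      using exponent_seq_mono_subseq .
    have "f (g 0) \<le> f (g 1)"
      using monoD[OF g(2), of 0 1] by simp
    moreover have "f n \<in> T" for n
      using f(2) by blast
    ultimately have "f (g 0) = f (g 1)"
      by (simp add: T_def)
    then have "g 0 = g 1"
      using f(1) by (simp add: inj_eq)
    then show False
      using g(1) by (metis strict_mono_eq zero_neq_one)
  qed
  moreover have "\<exists>t\<in>T. t \<le> m" if "m \<in> S" for m
    using that
  proof (induction "sum m UNIV" arbitrary: m rule: less_induct)
    case less
    show ?case
    proof (cases "m \<in> T")
      case False
      then obtain s where s: "s \<in> S" "s \<le> m" "s \<noteq> m"
        using less.prems by (auto simp: T_def)
      then obtain v where "s v < m v"
        by (metis le_fun_def less_le ext)
      then have "sum s UNIV < sum m UNIV"
        using s(2) by (intro sum_strict_mono_ex1) (auto simp: le_fun_def)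
      then show ?thesis
        using less.hyps s by (meson order_trans)
    qed auto
  qed
  ultimately show ?thesis
    by (intro that[of T]) (auto simp: T_def)
qed

text \<open>Values in the naturals allow the division to proceed in stages 0, 1, 2, ...; injectivity
  means that each stage deals with at most one monomial.\<close>

lemma ex_monomial_weight:
  obtains N :: "('v::finite \<Rightarrow> nat) \<Rightarrow> nat" where
    "inj N" "\<And>a b. N (a + b) = N a * N b" "\<And>q a. N (\<lambda>v. q * a v) = N a ^ q" "\<And>a. N a > 0"
proof -
  obtain P :: "nat set" where P: "finite P" "card P = card (UNIV :: 'v set)" "P \<subseteq> {p. prime p}"
    using infinite_arbitrarily_large[OF primes_infinite] by blast
  then obtain \<pi> where \<pi>: "bij_betw \<pi> (UNIV :: 'v set) P"
    by (metis finite finite_same_card_bij)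
  have prime: "prime (\<pi> v)" for v
    using \<pi> P(3) by (auto simp: bij_betw_def)
  have inj: "inj \<pi>"
    using \<pi> by (simp add: bij_betw_def)
  \<comment> \<open>Unique factorization gives a multiplicative monomial order of order type \<open>\<omega>\<close>.\<close>
  define N where "N = (\<lambda>m :: 'v \<Rightarrow> nat. \<Prod>v\<in>UNIV. \<pi> v ^ m v)"
  have "multiplicity (\<pi> v) (N m) = m v" for v m
  proof -
    have "N m = (\<Prod>x\<in>range \<pi>. x ^ m (inv_into UNIV \<pi> x))"
      unfolding N_def using inj by (subst prod.reindex) auto
    then show ?thesis
      using inj prime multiplicity_prod_prime_powers[of "range \<pi>" "\<pi> v" "\<lambda>x. m (inv_into UNIV \<pi> x)"] by auto
  qed
  then have "inj N"
    by (metis injI ext)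
  moreover have "N (a + b) = N a * N b" "N (\<lambda>v. q * a v) = N a ^ q" "N a > 0" for a b q
    using prime_gt_0_nat[OF prime]
    by (auto simp: N_def power_add prod.distrib prod_power_distrib mult.commute[of q] power_mult
        intro!: prod_pos)
  ultimately show ?thesis
    using that by blast
qed

section \<open>Detecting Frobenius powers by p^(-e)-linear maps\<close>

lemma monom_mult_power_in_hull:
  fixes C :: "('v::finite, 'k::comm_ring_1) mps set"
  assumes "C = polys \<or> C = UNIV" "g \<in> I" "I \<subseteq> C"
  shows "monom a c * g ^ q \<in> ideal_hull C ((\<lambda>g. g ^ q) ` I)"
proof -
  have C: "subring_set C"
    using assms(1) polys.subring_set_axioms all.subring_set_axioms by blast
  have "ideal_in C (ideal_hull C ((\<lambda>g. g ^ q) ` I))"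
    using assms subring_set.power_in[OF C] by (intro subring_set.ideal_hull_ideal[OF C]) auto
  moreover have "monom a c \<in> C"
    using assms(1) monom_in_polys by blast
  moreover have "g ^ q \<in> ideal_hull C ((\<lambda>g. g ^ q) ` I)"
    using assms(2) by (intro subsetD[OF ideal_hull_superset] imageI)
  ultimately show ?thesis
    by (rule ideal_inD(4))
qed

text \<open>Take m in the support, \<alpha> = m mod q and l with value 1 at the coefficient of m.
  The element u = s_m x^\<alpha> g^q, with g the coordinate of s, has coefficient s_m l(s_n)^q at
  each n above \<alpha> congruent to it, and 0 elsewhere. So u agrees with s at m and vanishes
  wherever s does: subtracting it shrinks the support. Since u is in the Frobenius power, the
  hypothesis on all \<phi> carries over to s - u.\<close>

lemma polys_in_hullI:
  fixes s :: "('v::finite, 'k::field) mps"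
  assumes p: "prime CHAR('k)" "q = CHAR('k) ^ e" and I: "ideal_in polys I" and s: "s \<in> polys"
    and \<phi>: "\<And>\<phi>. \<phi> \<in> cartier_maps polys q \<Longrightarrow> \<phi> s \<in> I"
  shows "s \<in> ideal_hull polys ((\<lambda>g. g ^ q) ` I)"
  using s \<phi>
proof (induction "card {m. coeff s m \<noteq> 0}" arbitrary: s rule: less_induct)
  case less
  let ?J = "ideal_hull polys ((\<lambda>g. g ^ q) ` I)"
  have q: "q > 0"
    using p by (simp add: prime_gt_0_nat)
  have J: "ideal_in polys ?J"
    using ideal_inD(1)[OF I] polys.power_in by (intro polys.ideal_hull_ideal) auto
  show ?case
  proof (cases "s = 0")
    case True
    then show ?thesis
      using ideal_inD(2)[OF J] by simp
  next
    case False
    then obtain m where m: "coeff s m \<noteq> 0"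
      by (auto simp: mps_eq_iff)
    obtain l where l: "l \<in> dual_maps q" "l (coeff s m) = 1"
      using ex_dual_map[OF p m] .
    define \<alpha> where "\<alpha> = (\<lambda>v. m v mod q)"
    have \<alpha>: "\<alpha> v < q" for v
      using q by (simp add: \<alpha>_def)
    define g where "g = coeff_map q l \<alpha> s"
    have g: "g \<in> I"
      unfolding g_def by (intro less.prems coeff_map_cartier[OF p l(1) \<alpha>]) auto
    define u where "u = monom \<alpha> (coeff s m) * g ^ q"
    have u: "u \<in> ?J"
      unfolding u_def using g ideal_inD(1)[OF I] by (intro monom_mult_power_in_hull) auto
    have coeff_u: "coeff u n = (if \<alpha> \<le> n \<and> (\<forall>v. q dvd (n - \<alpha>) v) then coeff s m * l (coeff s n) ^ q else 0)" for n
    proof -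
      have "(\<lambda>v. q * ((n v - \<alpha> v) div q) + \<alpha> v) = n" if "\<alpha> \<le> n" "\<forall>v. q dvd (n - \<alpha>) v"
        using that by (auto simp: le_fun_def)
      then show ?thesis
        unfolding u_def g_def by (auto simp: coeff_monom_mult coeff_power_char[OF p] coeff_coeff_map)
    qed
    have "coeff u m = coeff s m"
      unfolding coeff_u using l(2) by (auto simp: \<alpha>_def le_fun_def minus_mod_eq_mult_div)
    moreover have "coeff u n = 0" if "coeff s n = 0" for n
      using that q dual_maps_0[OF l(1)] by (simp add: coeff_u zero_power)
    ultimately have "{n. coeff (s - u) n \<noteq> 0} \<subseteq> {n. coeff s n \<noteq> 0} - {m}"
      by auto
    then have "{n. coeff (s - u) n \<noteq> 0} \<subset> {n. coeff s n \<noteq> 0}"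
      using m by blast
    then have "card {n. coeff (s - u) n \<noteq> 0} < card {n. coeff s n \<noteq> 0}"
      using less.prems(1) by (intro psubset_card_mono) (auto simp: polys_def)
    moreover have "u \<in> polys"
      using u ideal_inD(1)[OF J] by blast
    moreover have "\<phi> (s - u) \<in> I" if "\<phi> \<in> cartier_maps polys q" for \<phi>
      using that less.prems(2)[OF that] polys.cartier_maps_ideal_hull[OF I u that]
      by (simp add: cartier_maps_diff polys.ideal_in_diff[OF I])
    ultimately have "s - u \<in> ?J"
      using less.prems(1) by (intro less.hyps polys.diff_in)
    then show ?thesis
      using ideal_inD(3)[OF J _ u, of "s - u"] by simp
  qed
qed

text \<open>Elimination as for polynomials need not stop and would use a new element of I each time.
  Instead every coordinate that arises has its leading exponent above some t in \<open>T\<close>, so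
  a multiple of the fixed \<open>G t ^ q\<close> does the elimination, and only its multipliers
  accumulate.\<close>

lemma series_in_hullI:
  fixes s :: "('v::finite, 'k::field) mps"
  assumes p: "prime CHAR('k)" "q = CHAR('k) ^ e" and I: "ideal_in UNIV I"
    and \<phi>: "\<And>\<phi>. \<phi> \<in> cartier_maps UNIV q \<Longrightarrow> \<phi> s \<in> I"
  shows "s \<in> ideal_hull UNIV ((\<lambda>g. g ^ q) ` I)"
proof -
  let ?J = "ideal_hull UNIV ((\<lambda>g. g ^ q) ` I)"
  have q: "q > 0"
    using p by (simp add: prime_gt_0_nat)
  have J: "ideal_in UNIV ?J"
    by (intro all.ideal_hull_ideal) auto
  obtain N :: "('v \<Rightarrow> nat) \<Rightarrow> nat" where N: "inj N" "\<And>a b. N (a + b) = N a * N b"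
      "\<And>q a. N (\<lambda>v. q * a v) = N a ^ q" "\<And>a. N a > 0"
    using ex_monomial_weight by blast
  have N_diff: "N m = N a * N (m - a)" if "a \<le> m" for a m
    using that N(2) by (metis add_diff_cancel_left' exponents_le_iff)
  \<comment> \<open>Leading means least weight, as suits power series: elimination proceeds upwards
    from the low monomials.\<close>
  define leads where "leads = (\<lambda>(h :: ('v, 'k) mps) m. coeff h m \<noteq> 0 \<and> (\<forall>n. coeff h n \<noteq> 0 \<longrightarrow> N m \<le> N n))"
  obtain T where T: "finite T" "T \<subseteq> {m. \<exists>h\<in>I. leads h m}" "\<forall>m\<in>{m. \<exists>h\<in>I. leads h m}. \<exists>t\<in>T. t \<le> m"
    by (rule Dickson)
  then have "\<forall>t\<in>T. \<exists>g. g \<in> I \<and> leads g t"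
    by blast
  then obtain G where G: "\<And>t. t \<in> T \<Longrightarrow> G t \<in> I \<and> leads (G t) t"
    using bchoice[of T "\<lambda>t g. g \<in> I \<and> leads g t"] by blast
  have G_power: "N (\<lambda>v. q * t v) \<le> N n" if "t \<in> T" "coeff (G t ^ q) n \<noteq> 0" for t n
  proof -
    have *: "\<forall>v. q dvd n v" "coeff (G t) (\<lambda>v. n v div q) \<noteq> 0"
      using that(2) q by (auto simp: coeff_power_char[OF p] zero_power split: if_splits)
    then have "N t \<le> N (\<lambda>v. n v div q)"
      using G[OF that(1)] by (auto simp: leads_def)
    then have "N t ^ q \<le> N (\<lambda>v. q * (n v div q))"
      unfolding N(3) by (rule power_mono) simp
    then show ?thesis
      using *(1) by (simp add: N(3))
  qed
  \<comment> \<open>Membership in \<open>K\<close> survives each subtraction, so the coordinates of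
    every intermediate remainder lie in I and are covered by \<open>T\<close>.\<close>
  define K where "K = {s. \<forall>\<phi> \<in> cartier_maps UNIV q. \<phi> s \<in> I}"
  have K: "s - (\<Sum>t\<in>T. d t * G t ^ q) \<in> K" if "s \<in> K" for s d
  proof -
    have "(\<Sum>t\<in>T. d t * G t ^ q) \<in> ?J"
      using G by (intro all.ideal_in_sum[OF J] ideal_inD(4)[OF J] subsetD[OF ideal_hull_superset] imageI) auto
    then show ?thesis
      using that all.cartier_maps_ideal_hull[OF I]
      unfolding K_def by (auto simp: cartier_maps_diff intro!: all.ideal_in_diff[OF I])
  qed
  \<comment> \<open>Stage n removes the monomial of weight n from s. A multiplier used at stage n only involves
    exponents a with \<open>N a * N (q t) = n\<close>, so the multipliers of all stages add up to a power series.\<close>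
  define clears where "clears = (\<lambda>n s d. (\<forall>t\<in>T. \<forall>a. coeff (d t) a \<noteq> 0 \<longrightarrow> N a * N (\<lambda>v. q * t v) = n) \<and>
      (\<forall>m. N m \<le> n \<longrightarrow> coeff (s - (\<Sum>t\<in>T. d t * G t ^ q)) m = 0))"
  have step: "\<exists>d. clears n s d"
    if sK: "s \<in> K" and low: "\<forall>m. N m < n \<longrightarrow> coeff s m = 0" for s n
  proof (cases "\<exists>m. N m = n \<and> coeff s m \<noteq> 0")
    case False
    then show ?thesis
      using low by (intro exI[of _ "\<lambda>_. 0"]) (auto simp: clears_def le_less)
  next
    case True
    then obtain m where m: "N m = n" "coeff s m \<noteq> 0"
      by blast
    obtain l where l: "l \<in> dual_maps q" "l (coeff s m) = 1"
      using ex_dual_map[OF p m(2)] .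
    define \<alpha> where "\<alpha> = (\<lambda>v. m v mod q)"
    define m' where "m' = (\<lambda>v. m v div q)"
    have \<alpha>: "\<alpha> v < q" for v
      using q by (simp add: \<alpha>_def)
    define h where "h = coeff_map q l \<alpha> s"
    have "h \<in> I"
      using sK coeff_map_cartier[OF p l(1), of \<alpha> UNIV] \<alpha> unfolding h_def K_def by simp
    moreover have "leads h m'"
      \<comment> \<open>Within the residue class of \<alpha> the weight of q b + \<alpha> is N(b)^q
        N(\<alpha>). Hence the least monomial of s, once divided by q, is least in h.\<close>
      unfolding leads_def
    proof (intro conjI allI impI)
      show "coeff h m' \<noteq> 0"
        using l(2) by (simp add: h_def coeff_coeff_map m'_def \<alpha>_def)
      fix b
      assume "coeff h b \<noteq> 0"
      then have "coeff s (\<lambda>v. q * b v + \<alpha> v) \<noteq> 0"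
        using dual_maps_0[OF l(1)] by (auto simp: h_def coeff_coeff_map)
      then have "n \<le> N (\<lambda>v. q * b v + \<alpha> v)"
        using low by (meson not_le)
      then have "N (\<lambda>v. q * m' v + \<alpha> v) \<le> N (\<lambda>v. q * b v + \<alpha> v)"
        using m(1) by (simp add: m'_def \<alpha>_def)
      moreover have "N (\<lambda>v. q * b v + \<alpha> v) = N b ^ q * N \<alpha>" for b
        using N(2)[of "\<lambda>v. q * b v" \<alpha>] N(3)[of q b] by (simp add: plus_fun_def)
      ultimately show "N m' \<le> N b"
        using N(4)[of \<alpha>] q by simp
    qed
    ultimately obtain t where t: "t \<in> T" "t \<le> m'"
      using T(3) by blast
    have qt: "(\<lambda>v. q * t v) \<le> m"
      using t(2) q by (auto simp: le_fun_def m'_def less_eq_div_iff_mult_less_eq mult.commute)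
    define a where "a = m - (\<lambda>v. q * t v)"
    have am: "a \<le> m" "m - a = (\<lambda>v. q * t v)"
      using qt by (auto simp: a_def le_fun_def fun_eq_iff)
    have Na: "N a * N (\<lambda>v. q * t v) = n"
      using N_diff[OF am(1)] am(2) m(1) by simp
    \<comment> \<open>The leading coefficient of \<open>G t ^ q\<close> is the q-th power of that of
      \<open>G t\<close>; dividing by it makes the coefficients at m cancel.\<close>
    define c where "c = coeff s m / coeff (G t) t ^ q"
    define d where "d = (\<lambda>u. if u = t then monom a c else 0)"
    have sum_d: "(\<Sum>u\<in>T. d u * G u ^ q) = monom a c * G t ^ q"
      using T(1) t(1) by (simp add: d_def if_distrib[of "\<lambda>x. x * _"] cong: if_cong)
    have "coeff (monom a c * G t ^ q) m = coeff s m"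
      using am q G[OF t(1)] by (simp add: coeff_monom_mult coeff_power_char[OF p] c_def leads_def)
    moreover have "coeff (monom a c * G t ^ q) b = 0" if "N b < n" for b
    proof (rule ccontr)
      assume "coeff (monom a c * G t ^ q) b \<noteq> 0"
      then have ab: "a \<le> b" "coeff (G t ^ q) (b - a) \<noteq> 0"
        by (auto simp: coeff_monom_mult split: if_splits)
      then have "n \<le> N b"
        using Na N_diff[OF ab(1)] G_power[OF t(1) ab(2)] by (metis mult_le_mono2)
      then show False
        using that by simp
    qed
    ultimately have "coeff (s - monom a c * G t ^ q) b = 0" if "N b \<le> n" for b
      using that low m(1) injD[OF N(1), of b m] by (cases "N b = n") auto
    then show ?thesis
      unfolding clears_def using Na
      by (intro exI[of _ d] conjI) (auto simp: sum_d, auto simp: d_def coeff_monom split: if_splits)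
  qed
  define \<delta> where "\<delta> = (\<lambda>n s. SOME d. clears n s d)"
  have \<delta>: "clears n s (\<delta> n s)" if "s \<in> K" "\<forall>m. N m < n \<longrightarrow> coeff s m = 0" for n s
    unfolding \<delta>_def using step[OF that] by (rule someI_ex)
  \<comment> \<open>The remainders: the multipliers of a stage depend on what the earlier stages
    have left.\<close>
  define st where "st = rec_nat s (\<lambda>n x. x - (\<Sum>t\<in>T. \<delta> n x t * G t ^ q))"
  have st_0: "st 0 = s" and st_Suc: "st (Suc n) = st n - (\<Sum>t\<in>T. \<delta> n (st n) t * G t ^ q)" for n
    by (simp_all add: st_def)
  have st: "st n \<in> K \<and> (\<forall>m. N m < n \<longrightarrow> coeff (st n) m = 0)" for n
  proof (induction n)
    case 0
    then show ?case
      using \<phi> by (simp add: st_0 K_def)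
  next
    case (Suc n)
    then show ?case
      unfolding st_Suc using K \<delta>[of "st n" n] by (auto simp: clears_def less_Suc_eq_le)
  qed
  define D where "D = (\<lambda>n. \<delta> n (st n))"
  have D: "N a * N (\<lambda>v. q * t v) = n" if "t \<in> T" "coeff (D n t) a \<noteq> 0" for n t a
    using \<delta>[of "st n" n] st[of n] that unfolding D_def clears_def by blast
  have st_D: "st (Suc n) = st n - (\<Sum>t\<in>T. D n t * G t ^ q)" for n
    by (simp add: st_Suc D_def)
  have st_sum: "st n = s - (\<Sum>t\<in>T. (\<Sum>i<n. D i t) * G t ^ q)" for n
    by (induction n) (simp_all add: st_0 st_D distrib_right sum.distrib)
  \<comment> \<open>The sum of all \<open>D i t\<close>: at exponent a only the stage i = N(a) N(q
    t) can contribute.\<close>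
  define r where "r = (\<lambda>t. Mps (\<lambda>a. coeff (D (N a * N (\<lambda>v. q * t v)) t) a))"
  have "s = (\<Sum>t\<in>T. r t * G t ^ q)"
  proof (rule mps_eqI)
    fix m
    \<comment> \<open>Stages up to N(m) have cleared the coefficient at m, and the multipliers of
      later stages produce only monomials of weight above N(m).\<close>
    define n where "n = Suc (N m)"
    have "coeff ((r t - (\<Sum>i<n. D i t)) * G t ^ q) m = 0" if t: "t \<in> T" for t
      unfolding coeff_mult
    proof (rule sum.neutral, rule ballI, rule ccontr)
      fix a
      assume a: "a \<in> {..m}" "coeff (r t - (\<Sum>i<n. D i t)) a * coeff (G t ^ q) (m - a) \<noteq> 0"
      let ?n = "N a * N (\<lambda>v. q * t v)"
      have "coeff (D i t) a = 0" if "i \<noteq> ?n" for i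
        using D[OF t] that by blast
      then have "(\<Sum>i<n. coeff (D i t) a) = (\<Sum>i<n. if i = ?n then coeff (D ?n t) a else 0)"
        by (intro sum.cong) auto
      then have "coeff (r t - (\<Sum>i<n. D i t)) a = (if ?n < n then 0 else coeff (D ?n t) a)"
        by (simp add: r_def)
      then have "N m < ?n"
        using a(2) by (auto simp: n_def split: if_splits)
      moreover have "?n \<le> N m"
        using N_diff[of a m] a G_power[OF t, of "m - a"] by auto
      ultimately show False
        by simp
    qed
    then have "coeff (r t * G t ^ q) m = coeff ((\<Sum>i<n. D i t) * G t ^ q) m" if "t \<in> T" for t
      using that by (simp add: left_diff_distrib)
    moreover have "coeff (st n) m = 0"
      using st[of n] by (simp add: n_def)
    ultimately show "coeff s m = coeff (\<Sum>t\<in>T. r t * G t ^ q) m"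
      by (simp add: st_sum)
  qed
  moreover have "(\<Sum>t\<in>T. r t * G t ^ q) \<in> ?J"
    using G by (intro all.ideal_in_sum[OF J] ideal_inD(4)[OF J] subsetD[OF ideal_hull_superset] imageI) auto
  ultimately show ?thesis
    by simp
qed

section \<open>Derivations and the Cartier operator\<close>

lemma derivation_power:
  fixes d :: "'a::comm_ring_1 \<Rightarrow> 'a"
  assumes "\<And>x y. d (x * y) = d x * y + x * d y"
  shows "d (x ^ Suc n) = of_nat (Suc n) * x ^ n * d x"
proof (induction n)
  case (Suc n)
  have "d (x ^ Suc (Suc n)) = d x * x ^ Suc n + x * d (x ^ Suc n)"
    using assms[of x "x ^ Suc n"] by simp
  then show ?case
    unfolding Suc.IH by (simp add: algebra_simps)
qed simp

text \<open>The witness is \<open>P = ((x + y)\<^sup>p - x\<^sup>p - y\<^sup>p) / p\<close> with \<open>p = n + 1\<close>, which has integer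
coefficients.\<close>

lemma derivation_power_add:
  fixes d :: "'a::comm_ring_1 \<Rightarrow> 'a"
  assumes p: "prime (Suc n)"
    and add: "\<And>x y. d (x + y) = d x + d y" and mult: "\<And>x y. d (x * y) = d x * y + x * d y"
  shows "\<exists>P. (x + y) ^ n * d (x + y) = x ^ n * d x + y ^ n * d y + d P"
proof -
  \<comment> \<open>Up to an index shift, the coefficients of P. The division by p takes place in
    the naturals, where it is exact and can be cancelled; in the ring p may be 0.\<close>
  define c where "c = (\<lambda>i. (Suc n choose Suc i) div Suc n)"
  have d_0: "d 0 = 0"
    using add[of 0 0] by simp
  have d_sum: "d (sum f A) = (\<Sum>i\<in>A. d (f i))" for f :: "nat \<Rightarrow> 'a" and A
    by (induction A rule: infinite_finite_induct) (auto simp: d_0 add)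
  have d_1: "d 1 = 0"
    using mult[of 1 1] by simp
  have d_of_nat: "d (of_nat k) = 0" for k
    by (induction k) (auto simp: d_0 d_1 add)
  have c: "Suc n * c i = Suc n choose Suc i" if "i < n" for i
    unfolding c_def using p that
    by (intro dvd_mult_div_cancel dvd_choose_prime) auto
  have c1: "c i * Suc i = n choose i" if "i < n" for i
  proof -
    have "Suc n * (c i * Suc i) = Suc n * (n choose i)"
      using c[OF that] Suc_times_binomial[of i n] by (metis mult.assoc mult.commute)
    then show ?thesis
      by (metis mult_cancel1 nat.distinct(1))
  qed
  have c2: "c i * (n - i) = n choose Suc i" if "i < n" for i
  proof -
    have "Suc n * (c i * (n - i)) = Suc n * (n choose Suc i)"
      using c[OF that] binomial_absorb_comp[of "Suc n" "Suc i"]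
      by (metis diff_Suc_1 diff_Suc_Suc mult.assoc mult.commute)
    then show ?thesis
      by (metis mult_cancel1 nat.distinct(1))
  qed
  define P where "P = (\<Sum>i<n. of_nat (c i) * (x ^ Suc i * y ^ (n - i)))"
  have "d P = (\<Sum>i<n. of_nat (n choose i) * x ^ i * y ^ (n - i) * d x +
      of_nat (n choose Suc i) * x ^ Suc i * y ^ (n - Suc i) * d y)"
    unfolding P_def d_sum
  proof (rule sum.cong)
    fix i
    assume "i \<in> {..<n}"
    then have i: "i < n"
      by simp
    then have "n - i = Suc (n - Suc i)"
      by simp
    then have dy: "d (y ^ (n - i)) = of_nat (n - i) * y ^ (n - Suc i) * d y"
      using derivation_power[of d y "n - Suc i", OF mult] by simp
    have "d (of_nat (c i) * (x ^ Suc i * y ^ (n - i))) =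
        of_nat (c i * Suc i) * x ^ i * y ^ (n - i) * d x + of_nat (c i * (n - i)) * x ^ Suc i * y ^ (n - Suc i) * d y"
      unfolding mult d_of_nat derivation_power[of d x i, OF mult] dy of_nat_mult by (simp add: algebra_simps)
    then show "d (of_nat (c i) * (x ^ Suc i * y ^ (n - i))) = of_nat (n choose i) * x ^ i * y ^ (n - i) * d x +
        of_nat (n choose Suc i) * x ^ Suc i * y ^ (n - Suc i) * d y"
      unfolding c1[OF i] c2[OF i] .
  qed simp
  also have "\<dots> = (\<Sum>i<n. of_nat (n choose i) * x ^ i * y ^ (n - i)) * d x +
      (\<Sum>i<n. of_nat (n choose Suc i) * x ^ Suc i * y ^ (n - Suc i)) * d y"
    by (simp add: sum.distrib sum_distrib_right)
  \<comment> \<open>Each of the two sums is the binomial expansion of (x + y)^n with one end term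
    missing: x^n here, y^n in the shifted sum.\<close>
  also have "(\<Sum>i<n. of_nat (n choose i) * x ^ i * y ^ (n - i)) = (x + y) ^ n - x ^ n"
    by (simp add: binomial_ring lessThan_Suc_atMost[symmetric])
  also have "(\<Sum>i<n. of_nat (n choose Suc i) * x ^ Suc i * y ^ (n - Suc i)) = (x + y) ^ n - y ^ n"
    unfolding binomial_ring lessThan_Suc_atMost[symmetric] sum.lessThan_Suc_shift by simp
  finally have "(x + y) ^ n * d (x + y) = x ^ n * d x + y ^ n * d y + d P"
    by (simp add: add algebra_simps)
  then show ?thesis ..
qed

definition pd :: "'v \<Rightarrow> ('v::finite, 'k::comm_ring_1) mps \<Rightarrow> ('v, 'k) mps" where
  "pd v f = Mps (pderiv_v v (coeff f))"

lemma coeff_pd: "coeff (pd v f) m = of_nat (Suc (m v)) * coeff f (m(v := Suc (m v)))"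
  by (simp add: pd_def pderiv_v_def)

lemma pd_add: "pd v (f + g) = pd v f + pd v g"
  by (rule mps_eqI) (simp add: coeff_pd distrib_left)

text \<open>Raising a by one at v turns the factor of the derivative into a(v), and the added terms
  with a(v) = 0 vanish. In this form the product rule is the identity a(v) + b(v) = m(v) +
  1.\<close>

lemma coeff_pd_mult:
  fixes f g :: "('v::finite, 'k::comm_ring_1) mps"
  shows "coeff (pd v f * g) m =
    (\<Sum>(a, b) \<in> {(a, b). a + b = m(v := Suc (m v))}. of_nat (a v) * coeff f a * coeff g b)"
proof -
  let ?M = "m(v := Suc (m v))"
  have "coeff (pd v f * g) m =
      (\<Sum>(a, b) \<in> {(a, b). a + b = ?M \<and> a v \<noteq> 0}. of_nat (a v) * coeff f a * coeff g b)"
    unfolding coeff_mult_pairs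
  proof (rule sum.reindex_bij_witness[of _ "\<lambda>(a, b). (a(v := a v - 1), b)" "\<lambda>(a, b). (a(v := Suc (a v)), b)"])
    fix x :: "('v \<Rightarrow> nat) \<times> ('v \<Rightarrow> nat)"
    assume "x \<in> {(a, b). a + b = ?M \<and> a v \<noteq> 0}"
    then obtain a b where x: "x = (a, b)" "a + b = ?M" "a v \<noteq> 0"
      by blast
    have "a w + b w = ?M w" for w
      using x(2) by (metis plus_fun_apply)
    then have "a(v := a v - 1) + b = m"
      using x(3) by (auto simp: fun_eq_iff split: if_splits)
    then show "(case x of (a, b) \<Rightarrow> (a(v := a v - 1), b)) \<in> {(a, b). a + b = m}"
      by (simp add: x)
  qed (auto simp: fun_eq_iff coeff_pd)
  also have "\<dots> = (\<Sum>(a, b) \<in> {(a, b). a + b = ?M}. of_nat (a v) * coeff f a * coeff g b)"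
    by (rule sum.mono_neutral_left) (auto intro!: Nat.gr0I)
  finally show ?thesis .
qed

lemma pd_mult: "pd v (f * g) = pd v f * g + f * pd v g"
proof (rule mps_eqI)
  fix m
  let ?M = "m(v := Suc (m v))"
  have "coeff (f * pd v g) m = coeff (pd v g * f) m"
    by (simp add: mult.commute)
  also have "\<dots> = (\<Sum>(a, b) \<in> {(a, b). a + b = ?M}. of_nat (b v) * coeff f a * coeff g b)"
    unfolding coeff_pd_mult
    by (rule sum.reindex_bij_witness[of _ "\<lambda>(a, b). (b, a)" "\<lambda>(a, b). (b, a)"]) (auto simp: ac_simps)
  finally have "coeff (pd v f * g + f * pd v g) m =
      (\<Sum>(a, b) \<in> {(a, b). a + b = ?M}. of_nat (a v + b v) * coeff f a * coeff g b)"
    by (simp add: coeff_pd_mult case_prod_unfold distrib_right flip: sum.distrib)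
  also have "\<dots> = (\<Sum>(a, b) \<in> {(a, b). a + b = ?M}. of_nat (Suc (m v)) * (coeff f a * coeff g b))"
  proof (rule sum.cong)
    fix x
    assume "x \<in> {(a, b). a + b = ?M}"
    then have "fst x v + snd x v = Suc (m v)"
      by (auto dest: fun_cong[of _ _ v])
    then show "(case x of (a, b) \<Rightarrow> of_nat (a v + b v) * coeff f a * coeff g b) =
        (case x of (a, b) \<Rightarrow> of_nat (Suc (m v)) * (coeff f a * coeff g b))"
      by (simp add: case_prod_unfold mult.assoc del: of_nat_add of_nat_Suc)
  qed simp
  also have "\<dots> = coeff (pd v (f * g)) m"
    by (simp add: coeff_pd coeff_mult_pairs sum_distrib_left case_prod_unfold)
  finally show "coeff (pd v (f * g)) m = coeff (pd v f * g + f * pd v g) m" ..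
qed

text \<open>Fermat's little theorem: the p-th power map is additive and fixes 1.\<close>

lemma of_nat_power_CHAR:
  assumes "prime CHAR('k::comm_ring_1)"
  shows "of_nat n ^ CHAR('k) = (of_nat n :: 'k)"
  using assms by (induction n) (auto simp: freshmans_dream prime_gt_0_nat zero_power)

text \<open>Coefficientwise form of the fact that the Cartier operator sends f^(p-1) df to df. Both
  sides are additive in f, the left one because the correction P enters only through its derivative;
  this leaves monomials and a tail that contributes 0.\<close>

lemma coeff_power_mult_pd:
  fixes f :: "('v::finite, 'k::comm_ring_1) mps"
  assumes p: "prime p" "CHAR('k) = p"
  shows "coeff (f ^ (p - 1) * pd v f) (\<lambda>w. p * m w + (if w = v then p - 1 else 0)) = coeff (pd v f) m ^ p"
proof -
  define M where "M = (\<lambda>w. p * m w + (if w = v then p - 1 else 0))"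
  define Q where "Q = (\<lambda>f :: ('v, 'k) mps. coeff (f ^ (p - 1) * pd v f) M = coeff (pd v f) m ^ p)"
  have p0: "p \<ge> 2"
    using p(1) prime_ge_2_nat by blast
  \<comment> \<open>Since M(v) + 1 is a multiple of p, every derivative \<open>pd v P\<close> has
    coefficient 0 at \<open>M\<close>.\<close>
  have M': "M(v := Suc (M v)) = (\<lambda>w. p * (m(v := Suc (m v))) w)"
    using p0 by (auto simp: M_def)
  have p_zero: "of_nat p = (0 :: 'k)"
    using p(2) by (metis of_nat_CHAR)
  have Q_add: "Q (f + g)" if "Q f" "Q g" for f g
  proof -
    obtain P where P: "(f + g) ^ (p - 1) * pd v (f + g) = f ^ (p - 1) * pd v f + g ^ (p - 1) * pd v g + pd v P"
      using derivation_power_add[of "p - 1" "pd v" f g, OF _ pd_add pd_mult] p(1) p0 by (auto simp: Suc_diff_Suc)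
    have "of_nat (Suc (M v)) = (0 :: 'k)"
      using fun_cong[OF M', of v] p_zero by (metis fun_upd_same mult_zero_left of_nat_mult)
    then have "coeff (pd v P) M = 0"
      by (simp add: coeff_pd del: of_nat_Suc)
    then show ?thesis
      using that p unfolding Q_def P by (simp add: pd_add freshmans_dream)
  qed
  have Q_monom: "Q (monom a c)" for a c
  proof -
    have pd_monom: "pd v (monom a c) = monom (a(v := a v - 1)) (of_nat (a v) * c)"
    proof (rule mps_eqI)
      fix n
      have "n(v := Suc (n v)) = a \<longleftrightarrow> n = a(v := a v - 1) \<and> a v \<noteq> 0"
        by (auto simp: fun_eq_iff)
      then show "coeff (pd v (monom a c)) n = coeff (monom (a(v := a v - 1)) (of_nat (a v) * c)) n"
        by (auto simp: coeff_pd coeff_monom simp del: of_nat_Suc)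
    qed
    show ?thesis
    proof (cases "a v = 0")
      case True
      then show ?thesis
        using p0 by (simp add: Q_def pd_monom coeff_monom coeff_monom_mult monom_power zero_power)
    next
      case False
      have *: "((\<lambda>w. (p - 1) * a w) + a(v := a v - 1)) = M \<longleftrightarrow> m = a(v := a v - 1)"
      proof -
        have "(p - 1) * a v + (a v - 1) = p * (a v - 1) + (p - 1)"
          using p0 False by (simp add: algebra_simps)
        moreover have "(p - 1) * a w + a w = p * a w" for w
          using p0 by (metis Suc_1 Suc_le_D add.commute diff_Suc_1 mult_Suc)
        ultimately have "((\<lambda>w. (p - 1) * a w) + a(v := a v - 1)) = (\<lambda>w. p * (a(v := a v - 1)) w + (if w = v then p - 1 else 0))"
          by (auto simp: fun_eq_iff)
        then show ?thesis
          using p0 unfolding M_def by (auto simp: fun_eq_iff)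
      qed
      have "c ^ (p - 1) * (of_nat (a v) * c) = (of_nat (a v) * c) ^ p"
        using of_nat_power_CHAR[where 'k = 'k, of "a v"] p p0
        by (simp add: power_mult_distrib power_eq_if[of c p])
      then show ?thesis
        using * p0 by (auto simp: Q_def pd_monom monom_power monom_mult_monom coeff_monom zero_power)
    qed
  qed
  have Q_sum: "Q (\<Sum>a\<in>A. monom a (h a))" for A h
  proof (induction A rule: infinite_finite_induct)
    case (insert x A)
    then show ?case
      by (simp add: Q_add Q_monom)
  qed (use p0 in \<open>auto simp: Q_def coeff_pd zero_power\<close>)
  \<comment> \<open>The cutoff exceeds \<open>M\<close> by one at v because the derivative reads one
    exponent higher. Both sides of \<open>Q h\<close> are then 0.\<close>
  define h where "h = f - cutoff (M(v := Suc (M v))) f"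
  have h: "coeff h a = 0" if "a \<le> M(v := Suc (M v))" for a
    using that by (simp add: h_def coeff_cutoff)
  have "Q h"
  proof -
    have "m(v := Suc (m v)) \<le> M(v := Suc (M v))"
      unfolding M' using p0 by (auto simp: le_fun_def)
    then have "coeff (pd v h) m = 0"
      by (simp add: coeff_pd h)
    moreover have "coeff (h * (h ^ (p - 2) * pd v h)) M = 0"
    proof (rule coeff_mult_eq_0)
      fix a
      assume "a \<le> M"
      also have "M \<le> M(v := Suc (M v))"
        by (auto simp: le_fun_def)
      finally show "coeff h a = 0"
        by (rule h)
    qed
    moreover have "h ^ (p - 1) = h * h ^ (p - 2)"
      using p0 by (metis Suc_diff_Suc Suc_1 less_eq_Suc_le power_Suc)
    ultimately show ?thesis
      using p0 by (simp add: Q_def mult.assoc zero_power)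
  qed
  moreover have "Q (cutoff (M(v := Suc (M v))) f)"
    unfolding cutoff_def by (rule Q_sum)
  ultimately have "Q (cutoff (M(v := Suc (M v))) f + h)"
    by (intro Q_add)
  then show ?thesis
    by (simp add: h_def Q_def M_def)
qed

text \<open>From p^(e+1) - 1 = (p^e - 1) p + (p - 1), the operator for p takes f^(p^e - 1) out of
  its p-th power and returns \<open>pd v f\<close> from the remaining factor; what is left is the
  case e.\<close>

lemma ex_cartier_map_pd:
  fixes C :: "('v::finite, 'k::field) mps set"
  assumes p: "prime p" "CHAR('k) = p" and C: "C = polys \<or> C = UNIV"
  shows "\<exists>\<phi> \<in> cartier_maps C (p ^ e). \<phi> (f ^ (p ^ e - 1) * pd v f) = pd v f"
proof (induction e)
  case 0
  show ?case
    by (rule bexI[of _ id]) (auto simp: cartier_maps_def)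
next
  case (Suc e)
  then obtain \<phi> where \<phi>: "\<phi> \<in> cartier_maps C (p ^ e)" "\<phi> (f ^ (p ^ e - 1) * pd v f) = pd v f"
    by blast
  have p0: "p \<ge> 2"
    using p(1) prime_ge_2_nat by blast
  \<comment> \<open>The normalization l(1) = 1 makes l a left inverse of the p-th power map.\<close>
  obtain l :: "'k \<Rightarrow> 'k" where l: "l \<in> dual_maps p" "l 1 = 1"
    by (rule ex_dual_map[where q = p and e = 1 and x = "1 :: 'k"]) (use p in auto)
  define \<alpha> where "\<alpha> = (\<lambda>w. if w = v then p - 1 else 0)"
  define \<psi> :: "('v, 'k) mps \<Rightarrow> ('v, 'k) mps" where "\<psi> = coeff_map p l \<alpha>"
  have \<psi>: "\<psi> \<in> cartier_maps C p"
    unfolding \<psi>_def using p p0 l(1) C by (intro coeff_map_cartier[of p 1]) (auto simp: \<alpha>_def)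
  have l_power: "l (c ^ p) = c" for c
  proof -
    have "l (c ^ p * 1) = c * l 1"
      using l(1) unfolding dual_maps_def by blast
    then show ?thesis
      using l(2) by simp
  qed
  have \<psi>_pd: "\<psi> (f ^ (p - 1) * pd v f) = pd v f"
    using coeff_power_mult_pd[OF p, of f v]
    by (intro mps_eqI) (simp add: \<psi>_def coeff_coeff_map \<alpha>_def l_power)
  have "p ^ Suc e - 1 = (p ^ e - 1) * p + (p - 1)"
    using p0 by (cases "p ^ e") (auto simp: mult.commute)
  then have "f ^ (p ^ Suc e - 1) * pd v f = (f ^ (p ^ e - 1)) ^ p * (f ^ (p - 1) * pd v f)"
    by (simp add: power_add power_mult mult.assoc)
  then have "(\<phi> \<circ> \<psi>) (f ^ (p ^ Suc e - 1) * pd v f) = pd v f"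
    using cartier_mapsD(3)[OF \<psi>] \<psi>_pd \<phi>(2) by simp
  moreover have "\<phi> \<circ> \<psi> \<in> cartier_maps C (p ^ Suc e)"
    using \<phi>(1) \<psi> by (auto simp: cartier_maps_def power_mult mult.commute[of p])
  ultimately show ?case
    by blast
qed

section \<open>Smallest Frobenius roots and the Jacobian ideal\<close>

lemma frob_hull_iff:
  fixes C :: "('v::finite, 'k::field) mps set"
  assumes p: "prime CHAR('k)" "q = CHAR('k) ^ e" and C: "C = polys \<or> C = UNIV" and I: "ideal_in C I"
  shows "s \<in> ideal_hull C ((\<lambda>g. g ^ q) ` I) \<longleftrightarrow> s \<in> C \<and> (\<forall>\<phi> \<in> cartier_maps C q. \<phi> s \<in> I)"
proof -
  interpret C: subring_set C
    using C polys.subring_set_axioms all.subring_set_axioms by blast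
  have "ideal_hull C ((\<lambda>g. g ^ q) ` I) \<subseteq> C"
    using ideal_inD(1)[OF I] C.power_in by (intro ideal_hull_least C.ideal_in_self) auto
  then show ?thesis
    using C I C.cartier_maps_ideal_hull[OF I, of s q] polys_in_hullI[OF p, of I s] series_in_hullI[OF p, of I s]
    by blast
qed

lemma ex_least_frob_root:
  fixes C :: "('v::finite, 'k::field) mps set"
  assumes p: "prime CHAR('k)" "q = CHAR('k) ^ e" and C: "C = polys \<or> C = UNIV" and s: "s \<in> C"
  obtains L where "ideal_in C L" "s \<in> ideal_hull C ((\<lambda>g. g ^ q) ` L)"
    "\<And>I. ideal_in C I \<Longrightarrow> s \<in> ideal_hull C ((\<lambda>g. g ^ q) ` I) \<Longrightarrow> L \<subseteq> I"
proof -
  interpret C: subring_set C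
    using C polys.subring_set_axioms all.subring_set_axioms by blast
  define \<A> where "\<A> = {I. ideal_in C I \<and> s \<in> ideal_hull C ((\<lambda>g. g ^ q) ` I)}"
  \<comment> \<open>The unit ideal qualifies because every \<phi> preserves \<open>C\<close>, so the
    intersection is over a nonempty family.\<close>
  have "C \<in> \<A>"
    using s by (auto simp: \<A>_def frob_hull_iff[OF p C] C.ideal_in_self cartier_mapsD(1))
  then have L: "ideal_in C (\<Inter>\<A>)"
    by (intro C.ideal_in_Inter) (auto simp: \<A>_def)
  moreover have "s \<in> ideal_hull C ((\<lambda>g. g ^ q) ` \<Inter>\<A>)"
    unfolding frob_hull_iff[OF p C L] using s by (auto simp: \<A>_def frob_hull_iff[OF p C])
  ultimately show ?thesis
    by (intro that[of "\<Inter>\<A>"]) (auto simp: \<A>_def)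
qed

lemma jacobian_in_frob_root:
  fixes C :: "('v::finite, 'k::field) mps set"
  assumes p: "prime p" "CHAR('k) = p" and C: "C = polys \<or> C = UNIV" and f: "f \<in> C"
    and I: "ideal_in C I" and m: "m < p ^ e" and fm: "f ^ m \<in> ideal_hull C ((\<lambda>g. g ^ (p ^ e)) ` I)"
  shows "f \<in> I" "pd v f \<in> I"
proof -
  interpret C: subring_set C
    using C polys.subring_set_axioms all.subring_set_axioms by blast
  have pk: "prime CHAR('k)" "p ^ e = CHAR('k) ^ e"
    using p by simp_all
  have q: "p ^ e > 0"
    using p prime_gt_0_nat by simp
  have J: "ideal_in C (ideal_hull C ((\<lambda>g. g ^ (p ^ e)) ` I))"
    using ideal_inD(1)[OF I] C.power_in by (intro C.ideal_hull_ideal) auto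
  have \<phi>: "\<phi> (f ^ n * t) \<in> I" if "\<phi> \<in> cartier_maps C (p ^ e)" "m \<le> n" "t \<in> C" for \<phi> n t
  proof -
    have "f ^ n * t = (f ^ (n - m) * t) * f ^ m"
      using that(2) by (metis (no_types, lifting) le_add_diff_inverse2 mult.assoc mult.commute power_add)
    moreover have "f ^ (n - m) * t \<in> C"
      using f that(3) by (intro C.mult_in C.power_in)
    ultimately have "f ^ n * t \<in> ideal_hull C ((\<lambda>g. g ^ (p ^ e)) ` I)"
      using ideal_inD(4)[OF J _ fm] by metis
    then show ?thesis
      using frob_hull_iff[OF pk C I] that(1) by blast
  qed
  \<comment> \<open>The coordinate at the monomial 1, normalized to send 1 to 1, sends f^q = f^q * 1
    to f.\<close>
  obtain l :: "'k \<Rightarrow> 'k" where l: "l \<in> dual_maps (p ^ e)" "l 1 = 1"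
    by (rule ex_dual_map[where q = "p ^ e" and e = e and x = "1 :: 'k"]) (use p in auto)
  let ?\<phi> = "coeff_map (p ^ e) l (\<lambda>_::'v. 0)"
  have "?\<phi> \<in> cartier_maps C (p ^ e)"
    using q by (intro coeff_map_cartier[OF pk l(1) _ C])
  moreover have "?\<phi> 1 = 1"
  proof (rule mps_eqI)
    fix a :: "'v \<Rightarrow> nat"
    have "(\<lambda>v. p ^ e * a v) = 0 \<longleftrightarrow> a = 0"
      using q by (auto simp: fun_eq_iff)
    then show "coeff (?\<phi> 1) a = coeff 1 a"
      using l dual_maps_0[OF l(1)] by (auto simp: coeff_coeff_map coeff_1)
  qed
  ultimately show "f \<in> I"
    using \<phi>[of ?\<phi> "p ^ e" 1] m cartier_mapsD(3)[of ?\<phi> C "p ^ e" f 1] C.one_in by simp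
  obtain \<psi> where \<psi>: "\<psi> \<in> cartier_maps C (p ^ e)" "\<psi> (f ^ (p ^ e - 1) * pd v f) = pd v f"
    using ex_cartier_map_pd[OF p C] by blast
  have "pd v f \<in> C"
  proof (cases "C = UNIV")
    case False
    then have "finite {m. coeff f m \<noteq> 0}"
      using f C by (auto simp: polys_def)
    moreover have "inj (\<lambda>m::'v \<Rightarrow> nat. m(v := Suc (m v)))"
      by (auto simp: inj_def fun_eq_iff split: if_splits)
    ultimately have "finite ((\<lambda>m. m(v := Suc (m v))) -` {m. coeff f m \<noteq> 0})"
      by (intro finite_vimageI)
    moreover have "{m. coeff (pd v f) m \<noteq> 0} \<subseteq> (\<lambda>m. m(v := Suc (m v))) -` {m. coeff f m \<noteq> 0}"
      by (auto simp: coeff_pd)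
    ultimately show ?thesis
      using False C finite_subset by (auto simp: polys_def)
  qed simp
  then show "pd v f \<in> I"
    using \<phi>[OF \<psi>(1), of "p ^ e - 1" "pd v f"] \<psi>(2) m by simp
qed

section \<open>Transfer to the rings of the statement\<close>

lemma mon_ring_simps:
  "carrier (mon_ring A) = A"
  "x \<otimes>\<^bsub>mon_ring A\<^esub> y = cmult x y" "\<one>\<^bsub>mon_ring A\<^esub> = coeff 1"
  "x \<oplus>\<^bsub>mon_ring A\<^esub> y = (\<lambda>m. x m + y m)" "\<zero>\<^bsub>mon_ring A\<^esub> = coeff 0"
  by (simp_all add: mon_ring_def one_mps.rep_eq zero_mps.rep_eq)

lemma poly_ring_eq: "(poly_ring :: ('v::finite, 'k::comm_ring_1) coeffs ring) = mon_ring (coeff ` polys)"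
proof -
  have "{f :: ('v, 'k) coeffs. finite {m. f m \<noteq> 0}} = coeff ` polys"
    by (auto simp: polys_def image_iff intro!: exI[of _ "Mps _"])
  then show ?thesis
    by (simp add: poly_ring_def)
qed

lemma pseries_ring_eq: "(pseries_ring :: ('v::finite, 'k::comm_ring_1) coeffs ring) = mon_ring (coeff ` UNIV)"
proof -
  have "range (coeff :: ('v, 'k) mps \<Rightarrow> _) = UNIV"
    by (metis coeff_Mps surjI)
  then show ?thesis
    by (simp add: pseries_ring_def)
qed

context
  fixes C :: "('v::finite, 'k::comm_ring_1) mps set"
  assumes C: "subring_set C"
begin

interpretation subring_set C
  by (rule C)

lemma ring_mon_ring: "ring (mon_ring (coeff ` C))"
proof -
  have *: "coeff f \<otimes>\<^bsub>mon_ring (coeff ` C)\<^esub> coeff g = coeff (f * g)"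
    "coeff f \<oplus>\<^bsub>mon_ring (coeff ` C)\<^esub> coeff g = coeff (f + g)" for f g
    by (simp_all add: mon_ring_simps times_mps.rep_eq plus_mps.rep_eq)
  have "abelian_group (mon_ring (coeff ` C))"
  proof (rule abelian_groupI)
    fix x
    assume "x \<in> carrier (mon_ring (coeff ` C))"
    then obtain f where "f \<in> C" "x = coeff f"
      by (auto simp: mon_ring_simps)
    then have "coeff (- f) \<oplus>\<^bsub>mon_ring (coeff ` C)\<^esub> x = \<zero>\<^bsub>mon_ring (coeff ` C)\<^esub>"
      by (simp add: * mon_ring_simps(5))
    then show "\<exists>y\<in>carrier (mon_ring (coeff ` C)). y \<oplus>\<^bsub>mon_ring (coeff ` C)\<^esub> x = \<zero>\<^bsub>mon_ring (coeff ` C)\<^esub>"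
      using \<open>f \<in> C\<close> uminus_in by (intro bexI[of _ "coeff (- f)"]) (auto simp: mon_ring_simps(1))
  qed (auto simp: * mon_ring_simps(1,3,5) add_in zero_in ac_simps)
  moreover have "monoid (mon_ring (coeff ` C))"
    by (rule monoidI) (auto simp: * mon_ring_simps(1,3,5) mult_in one_in ac_simps)
  ultimately show ?thesis
    by (rule ringI) (auto simp: * mon_ring_simps(1,3,5) algebra_simps)
qed

lemma nat_pow_mon_ring: "coeff f [^]\<^bsub>mon_ring (coeff ` C)\<^esub> (n :: nat) = coeff (f ^ n)"
proof (induction n)
  case 0
  show ?case
    by (simp add: nat_pow_def mon_ring_simps)
next
  case (Suc n)
  then show ?case
    by (simp add: nat_pow_def mon_ring_simps times_mps.rep_eq[symmetric] mult.commute)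
qed

lemma ideal_mon_ring_iff: "ideal J (mon_ring (coeff ` C)) \<longleftrightarrow> (\<exists>I. ideal_in C I \<and> J = coeff ` I)"
proof
  assume J: "ideal J (mon_ring (coeff ` C))"
  interpret J: ideal J "mon_ring (coeff ` C)"
    by (rule J)
  have "J \<subseteq> coeff ` C"
    using J.a_subset by (simp add: mon_ring_simps)
  then have J_eq: "J = coeff ` (coeff -` J)"
    by auto
  have "coeff -` J \<subseteq> C"
    using \<open>J \<subseteq> coeff ` C\<close> by (auto simp: coeff_inject)
  moreover have "0 \<in> coeff -` J"
    using additive_subgroup.zero_closed[OF J.additive_subgroup_axioms] by (simp add: mon_ring_simps)
  moreover have "f + g \<in> coeff -` J" if "f \<in> coeff -` J" "g \<in> coeff -` J" for f g
    using additive_subgroup.a_closed[OF J.additive_subgroup_axioms, of "coeff f" "coeff g"] that by (simp add: mon_ring_simps plus_mps.rep_eq)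
  moreover have "r * f \<in> coeff -` J" if "r \<in> C" "f \<in> coeff -` J" for r f
    using J.I_l_closed[of "coeff f" "coeff r"] that by (simp add: mon_ring_simps times_mps.rep_eq)
  ultimately have "ideal_in C (coeff -` J)"
    unfolding ideal_in_def by (intro conjI ballI)
  then show "\<exists>I. ideal_in C I \<and> J = coeff ` I"
    using J_eq by (intro exI[of _ "coeff -` J"] conjI)
next
  assume "\<exists>I. ideal_in C I \<and> J = coeff ` I"
  then obtain I where I: "ideal_in C I" "J = coeff ` I"
    by blast
  interpret R: ring "mon_ring (coeff ` C)"
    by (rule ring_mon_ring)
  have *: "coeff f \<otimes>\<^bsub>mon_ring (coeff ` C)\<^esub> coeff g = coeff (f * g)"
    "coeff f \<oplus>\<^bsub>mon_ring (coeff ` C)\<^esub> coeff g = coeff (f + g)" for f g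
    by (simp_all add: mon_ring_simps times_mps.rep_eq plus_mps.rep_eq)
  have mult_I: "f * r \<in> I" if "f \<in> I" "r \<in> C" for f r
    using ideal_inD(4)[OF I(1) that(2,1)] by (simp add: mult.commute)
  show "ideal J (mon_ring (coeff ` C))"
  proof (rule idealI)
    show "ring (mon_ring (coeff ` C))"
      by (rule ring_mon_ring)
    show "subgroup J (add_monoid (mon_ring (coeff ` C)))"
    proof (rule R.add.subgroupI)
      fix x
      assume "x \<in> J"
      then obtain f where f: "f \<in> I" "x = coeff f"
        using I(2) by blast
      then have "f \<in> C"
        using ideal_inD(1)[OF I(1)] by blast
      have "\<ominus>\<^bsub>mon_ring (coeff ` C)\<^esub> x = coeff (- f)"
        using \<open>f \<in> C\<close> f(2) uminus_in
        by (intro R.minus_equality) (auto simp: mon_ring_simps(1,5) *)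
      then show "\<ominus>\<^bsub>mon_ring (coeff ` C)\<^esub> x \<in> J"
        using f(1) I(2) ideal_in_uminus[OF I(1)] by simp
    qed (use I ideal_inD[OF I(1)] in \<open>auto simp: mon_ring_simps(1,5) *\<close>)
  qed (use I(2) ideal_inD(4)[OF I(1)] mult_I in \<open>auto simp: mon_ring_simps(1,5) *\<close>)
qed

lemma genideal_mon_ring: "genideal (mon_ring (coeff ` C)) (coeff ` S) = coeff ` ideal_hull C S" if "S \<subseteq> C"
proof -
  have "coeff ` S \<subseteq> coeff ` I \<longleftrightarrow> S \<subseteq> I" for I
    by (simp add: inj_image_subset_iff inj_def coeff_inject)
  then have "{J. ideal J (mon_ring (coeff ` C)) \<and> coeff ` S \<subseteq> J} = (`) coeff ` {I. ideal_in C I \<and> S \<subseteq> I}"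
    unfolding ideal_mon_ring_iff by blast
  \<comment> \<open>A member of the family, used together with injectivity of \<open>coeff\<close>
    to exchange image and intersection.\<close>
  moreover have "C \<in> {I. ideal_in C I \<and> S \<subseteq> I}"
    using ideal_in_self that by auto
  then have "coeff ` \<Inter>{I. ideal_in C I \<and> S \<subseteq> I} = \<Inter>((`) coeff ` {I. ideal_in C I \<and> S \<subseteq> I})"
    using image_INT[of coeff UNIV "{I. ideal_in C I \<and> S \<subseteq> I}" "\<lambda>I. I" C]
    by (simp add: inj_def coeff_inject)
  ultimately show ?thesis
    by (simp only: genideal_def ideal_hull_def)
qed

lemma frob_pow_mon_ring: "frob_pow (mon_ring (coeff ` C)) q (coeff ` I) = coeff ` ideal_hull C ((\<lambda>g. g ^ q) ` I)" if "I \<subseteq> C"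
proof -
  have "{g [^]\<^bsub>mon_ring (coeff ` C)\<^esub> q | g. g \<in> coeff ` I} = (\<lambda>g. coeff g [^]\<^bsub>mon_ring (coeff ` C)\<^esub> q) ` I"
    by auto
  then have "{g [^]\<^bsub>mon_ring (coeff ` C)\<^esub> q | g. g \<in> coeff ` I} = coeff ` (\<lambda>g. g ^ q) ` I"
    by (simp add: image_image nat_pow_mon_ring)
  moreover have "(\<lambda>g. g ^ q) ` I \<subseteq> C"
    using that power_in by auto
  ultimately show ?thesis
    using genideal_mon_ring by (simp add: frob_pow_def)
qed

end

section \<open>The Jacobian ideal and the test ideal\<close>

lemma Jac_subset_test_ideal:
  fixes C :: "('v::finite, 'k::field) mps set" and \<epsilon> :: real
  assumes p: "prime p" "CHAR('k) = p" and C: "C = polys \<or> C = UNIV" and f: "f \<in> C"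
    and eps: "0 < \<epsilon>" "\<epsilon> \<le> 1"
  shows "Jac (mon_ring (coeff ` C)) (coeff f) \<subseteq> test_ideal_principal (mon_ring (coeff ` C)) p (coeff f) (1 - \<epsilon>)"
proof -
  let ?R = "mon_ring (coeff ` C)"
  have sub: "subring_set C"
    using C polys.subring_set_axioms all.subring_set_axioms by blast
  then interpret subring_set C .
  have "real p > 1"
    using p(1) prime_gt_1_nat by simp
  then obtain e0 where "1 / \<epsilon> < real p ^ e0"
    using real_arch_pow by blast
  \<comment> \<open>The union defining the test ideal starts at e = 1, whereas \<open>e0\<close> may
    be 0.\<close>
  also have "real p ^ e0 \<le> real p ^ Suc e0"
    using \<open>real p > 1\<close> by (intro power_increasing) auto
  finally obtain e where e: "e \<ge> 1" "1 / \<epsilon> < real p ^ e"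
    by (metis Suc_eq_plus1_left le_add1)
  define m where "m = nat \<lceil>(1 - \<epsilon>) * real p ^ e\<rceil>"
  \<comment> \<open>The bound q - 1 is an integer, so it survives rounding up.\<close>
  have "(1 - \<epsilon>) * real p ^ e \<le> real_of_int (int (p ^ e) - 1)"
    using e(2) eps(1) by (simp add: field_simps)
  then have "\<lceil>(1 - \<epsilon>) * real p ^ e\<rceil> \<le> int (p ^ e) - 1"
    by (simp only: ceiling_le_iff)
  then have m: "m < p ^ e"
    using zero_less_power[OF prime_gt_0_nat[OF p(1)], of e] unfolding m_def by linarith
  have pk: "prime CHAR('k)" "p ^ e = CHAR('k) ^ e"
    using p by simp_all
  obtain L where L: "ideal_in C L" "f ^ m \<in> ideal_hull C ((\<lambda>g. g ^ (p ^ e)) ` L)"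
    "\<And>I. ideal_in C I \<Longrightarrow> f ^ m \<in> ideal_hull C ((\<lambda>g. g ^ (p ^ e)) ` I) \<Longrightarrow> L \<subseteq> I"
    using ex_least_frob_root[OF pk C power_in[OF f]] by metis
  have gen: "genideal ?R {coeff (f ^ m)} \<subseteq> frob_pow ?R (p ^ e) (coeff ` I) \<longleftrightarrow>
      f ^ m \<in> ideal_hull C ((\<lambda>g. g ^ (p ^ e)) ` I)" if "ideal_in C I" for I
  proof -
    have I: "I \<subseteq> C" "ideal_in C (ideal_hull C ((\<lambda>g. g ^ (p ^ e)) ` I))"
      using ideal_inD(1)[OF that] power_in by (auto intro!: ideal_hull_ideal)
    have "genideal ?R {coeff (f ^ m)} = coeff ` ideal_hull C {f ^ m}"
      using genideal_mon_ring[OF sub, of "{f ^ m}"] power_in[OF f] by simp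
    moreover have "ideal_hull C {f ^ m} \<subseteq> ideal_hull C ((\<lambda>g. g ^ (p ^ e)) ` I) \<longleftrightarrow>
        f ^ m \<in> ideal_hull C ((\<lambda>g. g ^ (p ^ e)) ` I)"
      using ideal_hull_superset[of "{f ^ m}" C] ideal_hull_least[OF I(2), of "{f ^ m}"] by auto
    ultimately show ?thesis
      by (simp add: frob_pow_mon_ring[OF sub I(1)] inj_image_subset_iff inj_def coeff_inject)
  qed
  have "I_e ?R p e (genideal ?R {coeff (f ^ m)}) = coeff ` L"
    unfolding I_e_def
  \<comment> \<open>\<open>LEAST\<close> refers to inclusion of sets and has a usable value only
    because \<open>L\<close> lies in every competing ideal.\<close>
  proof (rule Least_equality)
    show "ideal (coeff ` L) ?R \<and> genideal ?R {coeff (f ^ m)} \<subseteq> frob_pow ?R (p ^ e) (coeff ` L)"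
      unfolding gen[OF L(1)] ideal_mon_ring_iff[OF sub] using L(1,2) by blast
  next
    fix J
    assume J: "ideal J ?R \<and> genideal ?R {coeff (f ^ m)} \<subseteq> frob_pow ?R (p ^ e) J"
    then have "\<exists>I. ideal_in C I \<and> J = coeff ` I"
      by (simp only: ideal_mon_ring_iff[OF sub])
    then obtain I where I: "ideal_in C I" "J = coeff ` I"
      by blast
    then show "coeff ` L \<subseteq> J"
      using J L(3)[OF I(1)] gen[OF I(1)] by (metis image_mono)
  qed
  moreover have "Jac ?R (coeff f) \<subseteq> coeff ` L"
  proof -
    have *: "f \<in> L" "pd v f \<in> L" for v
      using jacobian_in_frob_root[OF p C f L(1) m L(2)] by auto
    have "pderiv_v v (coeff f) = coeff (pd v f)" for v
      by (simp add: pd_def)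
    then have "insert (coeff f) (range (\<lambda>v. pderiv_v v (coeff f))) \<subseteq> coeff ` L"
      using * by auto
    moreover have "ideal (coeff ` L) ?R"
      unfolding ideal_mon_ring_iff[OF sub] using L(1) by blast
    ultimately show ?thesis
      unfolding Jac_def genideal_def by blast
  qed
  moreover have "I_e ?R p e (genideal ?R {coeff (f ^ m)}) \<subseteq> test_ideal_principal ?R p (coeff f) (1 - \<epsilon>)"
    unfolding test_ideal_principal_def nat_pow_mon_ring[OF sub] m_def using e(1) by (intro UN_upper) simp
  ultimately show ?thesis
    by simp
qed

theorem mainTheorem1:
  fixes p :: nat and \<epsilon> :: real
  assumes char: "CHAR('k::field) = p" and ppos: "p > 0"
    and eps: "0 < \<epsilon>" "\<epsilon> \<le> 1"
  shows "(F_finite_field TYPE('k) p \<longrightarrow>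
            (\<forall>f \<in> carrier (poly_ring :: ('v::finite, 'k) coeffs ring).
               Jac poly_ring f \<subseteq> test_ideal_principal poly_ring p f (1 - \<epsilon>)))
       \<and> (\<forall>f \<in> carrier (pseries_ring :: ('v::finite, 'k) coeffs ring).
               Jac pseries_ring f \<subseteq> test_ideal_principal pseries_ring p f (1 - \<epsilon>))"
proof -
  have "prime p"
    using char ppos prime_CHAR_semidom[where 'a = 'k] by simp
  then show ?thesis
    using Jac_subset_test_ideal[OF _ char _ _ eps, where C = "polys :: ('v, 'k) mps set"]
      Jac_subset_test_ideal[OF _ char _ _ eps, where C = "UNIV :: ('v, 'k) mps set"]
    unfolding poly_ring_eq pseries_ring_eq mon_ring_simps(1) by blast
qed

end
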